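(* Let $n\ge1$, $p_1,\dots,p_n\in(0,1)$, $\beta\ge0$, $\alpha\ge0$ with $\alpha p_j<1$ for $1\le j\le n$, and let $L_{\alpha,\beta}(2n,2n)$ be the last passage time from $(1,1)$ to $(2n,2n)$ on the doubly symmetric random weight array with these parameters described in the context. Let $$c_{\alpha,\beta}=\prod_{1\le i<j\le n}\frac{1}{(1-p_ip_j)^2}\prod_{1\le j\le n}\frac{1+\beta p_j}{1-p_j^2}\cdot\frac{1}{1-\alpha p_j}.$$ Then for all $u\in\frac12\mathbb{Z}_{\ge0}$, $$c_{\alpha,\beta}\cdot\mathbb{P}\big(L_{\alpha,\beta}(2n,2n)\le 2u\big)=\Big[\prod_{i=1}^np_i\Big]^u\sum_{\lambda\subseteq u^n}\alpha^{\mathrm{oddrows}(u^n-\lambda)'}\cdot\mathrm{s}^{\mathrm{CB}}_\lambda(p_1,\dots,p_n;\beta).$$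
   Context: Last passage percolation: set $p_{2n-i+1}=p_i$ for $1\le i\le n$. $\{W_{i,j}:1\le i,j\le 2n\}$ is an array of random variables with $W_{i,j}=W_{2n-j+1,2n-i+1}=W_{j,i}$ for all $(i,j)$, such that the weights with $i\le j\le 2n-i+1$ are independent and, for $k\in\mathbb{Z}_{\ge0}$: $\mathbb{P}(W_{i,j}=k)=(1-p_ip_j)(p_ip_j)^k$ if $i<j<2n-i+1$; $\mathbb{P}(W_{i,j}=k)=\frac{1-p_j^2}{1+\beta p_j}\beta^{k\bmod2}p_j^k$ if $i<j=2n-i+1$; $\mathbb{P}(W_{j,j}=k)=(1-\alpha p_j)(\alpha p_j)^k$ if $1\le j\le n$ (with $0^0=1$). $L_{\alpha,\beta}(2n,2n)=\max_\pi\sum_{(i,j)\in\pi}W_{i,j}$, the maximum being over directed paths $\pi$ from $(1,1)$ to $(2n,2n)$, i.e. paths with steps $(1,0)$ or $(0,1)$. Partitions: a half-integer is an element of $\frac12+\mathbb{Z}$. An $n$-partition (resp. $n$-half-partition) is an $n$-tuple $\lambda_1\ge\dots\ge\lambda_n\ge0$ of integers (resp. half-integers). $u^n=(u,\dots,u)$. A sum over $\lambda\subseteq u^n$ is over all $n$-partitions (if $u$ is an integer) or all $n$-half-partitions (if $u$ is a half-integer) with $\lambda_1\le u$. For such $\lambda$, $u^n-\lambda=(u-\lambda_n,\dots,u-\lambda_1)$, an integer partition; $\mu'$ is the conjugate of $\mu$ and $\mathrm{oddrows}\,\mu$ the number of odd parts of $\mu$, so $\mathrm{oddrows}(u^n-\lambda)'=\sum_{i=1}^n(-1)^{n-i}(u-\lambda_i)$.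 CB-interpolating Schur polynomials: a split orthogonal pattern of height $2n$ is an array $z=(z_{i,j})_{1\le i\le 2n,\,1\le j\le\lceil i/2\rceil}$ such that $z_{i+1,j+1}\le z_{i,j}\le z_{i+1,j}$ (each inequality whenever both entries exist), the odd ends $z_{2i-1,i}$ ($1\le i\le n$) lie in $\frac12\mathbb{Z}_{\ge0}$, and the other entries lie either all in $\mathbb{Z}_{\ge0}$ or all in $\frac12+\mathbb{Z}_{\ge0}$. Its shape is its last row; $\mathrm{type}(z)_i=\sum_{j=1}^{\lceil i/2\rceil}z_{i,j}-\sum_{j=1}^{\lceil(i-1)/2\rceil}z_{i-1,j}$. If $z_{2n,1}$ is an integer (resp. half-integer), its atypical entries are its half-integer (resp. integer) entries; $|\mathfrak a(z)|$ is their number. For an $n$-partition or $n$-half-partition $\lambda$, $$\mathrm{s}^{\mathrm{CB}}_\lambda(x_1,\dots,x_n;\beta)=\sum_{z}\beta^{|\mathfrak a(z)|}\prod_{i=1}^n x_i^{\mathrm{type}(z)_{2i}-\mathrm{type}(z)_{2i-1}},$$ the sum being over split orthogonal patterns of height $2n$ and shape $\lambda$. *)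

theory Defs
  imports "HOL-Probability.Probability"
begin

subsection \<open>Last passage percolation on a doubly symmetric array\<close>

text \<open>Only the values \<open>p 1, \<dots>, p n\<close> are data; this is the extension
  \<open>p\<^bsub>2n-i+1\<^esub> = p\<^bsub>i\<^esub>\<close> to the indices \<open>1, \<dots>, 2n\<close>.\<close>

definition reflect :: "nat \<Rightarrow> (nat \<Rightarrow> real) \<Rightarrow> nat \<Rightarrow> real" where
  "reflect n p j = (if j \<le> n then p j else p (2 * n + 1 - j))"

text \<open>The three laws below are probability distributions on the nonnegative integers,
  so the weights are taken to be \<open>nat\<close>-valued.\<close>

locale doubly_symmetric_weights = prob_space M
  for M :: "'a measure" +
  fixes n :: nat and p :: "nat \<Rightarrow> real" and \<alpha> \<beta> :: real
    and W :: "nat \<Rightarrow> nat \<Rightarrow> 'a \<Rightarrow> nat"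
  assumes symmetric:
    "\<And>i j \<omega>. i \<in> {1..2*n} \<Longrightarrow> j \<in> {1..2*n} \<Longrightarrow> \<omega> \<in> space M \<Longrightarrow>
       W i j \<omega> = W (2*n + 1 - j) (2*n + 1 - i) \<omega> \<and> W i j \<omega> = W j i \<omega>"
  and indep:
    "indep_vars (\<lambda>_. count_space UNIV) (\<lambda>(i, j). W i j)
       {(i, j). i \<in> {1..2*n} \<and> j \<in> {1..2*n} \<and> i \<le> j \<and> j \<le> 2*n + 1 - i}"
  and law_generic:
    "\<And>i j k. i \<in> {1..2*n} \<Longrightarrow> j \<in> {1..2*n} \<Longrightarrow> i < j \<Longrightarrow> j < 2*n + 1 - i \<Longrightarrow>
       prob {\<omega> \<in> space M. W i j \<omega> = k}
         = (1 - reflect n p i * reflect n p j) * (reflect n p i * reflect n p j) ^ k"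
  and law_antidiagonal:
    "\<And>i j k. i \<in> {1..2*n} \<Longrightarrow> j \<in> {1..2*n} \<Longrightarrow> i < j \<Longrightarrow> j = 2*n + 1 - i \<Longrightarrow>
       prob {\<omega> \<in> space M. W i j \<omega> = k}
         = (1 - (reflect n p j)\<^sup>2) / (1 + \<beta> * reflect n p j)
             * \<beta> ^ (k mod 2) * (reflect n p j) ^ k"
  and law_diagonal:
    "\<And>j k. j \<in> {1..n} \<Longrightarrow>
       prob {\<omega> \<in> space M. W j j \<omega> = k} = (1 - \<alpha> * p j) * (\<alpha> * p j) ^ k"

definition directed_paths :: "nat \<times> nat \<Rightarrow> nat \<times> nat \<Rightarrow> (nat \<times> nat) list set" where
  "directed_paths a b = {\<pi>. \<pi> \<noteq> [] \<and> hd \<pi> = a \<and> last \<pi> = b \<and>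
     successively (\<lambda>(i, j) q. q = (i + 1, j) \<or> q = (i, j + 1)) \<pi>}"

definition last_passage_time :: "(nat \<Rightarrow> nat \<Rightarrow> nat) \<Rightarrow> nat \<Rightarrow> nat \<Rightarrow> nat" where
  "last_passage_time w k l =
     Max ((\<lambda>\<pi>. \<Sum>(i, j)\<leftarrow>\<pi>. w i j) ` directed_paths (1, 1) (k, l))"

subsection \<open>Partitions and half-partitions\<close>

definition half_integers :: "real set" where
  "half_integers = {x. x - 1/2 \<in> \<int>}"

text \<open>An \<open>n\<close>-tuple is a function on \<open>{1..n}\<close>; extensionality (a fixed value outside of
  \<open>{1..n}\<close>) makes the representation unique, so that sums over tuples count each once.\<close>

definition n_partition :: "nat \<Rightarrow> (nat \<Rightarrow> real) \<Rightarrow> bool" where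
  "n_partition n lam \<longleftrightarrow> lam \<in> extensional {1..n} \<and> antimono_on {1..n} lam \<and>
     (\<forall>i\<in>{1..n}. lam i \<in> \<int> \<and> 0 \<le> lam i)"

definition n_half_partition :: "nat \<Rightarrow> (nat \<Rightarrow> real) \<Rightarrow> bool" where
  "n_half_partition n lam \<longleftrightarrow> lam \<in> extensional {1..n} \<and> antimono_on {1..n} lam \<and>
     (\<forall>i\<in>{1..n}. lam i \<in> half_integers \<and> 0 \<le> lam i)"

text \<open>The index set \<open>\<lambda> \<subseteq> u\<^sup>n\<close>, for \<open>u\<close> an integer or a half-integer.\<close>

definition partitions_in_box :: "nat \<Rightarrow> real \<Rightarrow> (nat \<Rightarrow> real) set" where
  "partitions_in_box n u =
     (if u \<in> \<int> then {lam. n_partition n lam \<and> lam 1 \<le> u}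
      else {lam. n_half_partition n lam \<and> lam 1 \<le> u})"

text \<open>Integer partitions are functions \<open>\<mu>\<close> whose parts are \<open>\<mu> 1 \<ge> \<mu> 2 \<ge> \<dots>\<close>, eventually
  \<open>0\<close>; the index \<open>0\<close> is not used.  For \<open>lam \<in> partitions_in_box n u\<close> the differences
  \<open>u - lam i\<close> are nonnegative integers, so that taking the floor changes nothing.\<close>

definition box_complement :: "nat \<Rightarrow> real \<Rightarrow> (nat \<Rightarrow> real) \<Rightarrow> nat \<Rightarrow> nat" where
  "box_complement n u lam i = (if i \<in> {1..n} then nat \<lfloor>u - lam (n + 1 - i)\<rfloor> else 0)"

definition conjugate :: "(nat \<Rightarrow> nat) \<Rightarrow> nat \<Rightarrow> nat" where
  "conjugate \<mu> k = card {i. 1 \<le> i \<and> k \<le> \<mu> i}"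

definition oddrows :: "(nat \<Rightarrow> nat) \<Rightarrow> nat" where
  "oddrows \<mu> = card {i. 1 \<le> i \<and> odd (\<mu> i)}"

subsection \<open>CB-interpolating Schur polynomials\<close>

text \<open>Note that \<open>\<lceil>i/2\<rceil> = (i + 1) div 2\<close> and \<open>\<lceil>(i-1)/2\<rceil> = i div 2\<close>.\<close>

definition pattern_index :: "nat \<Rightarrow> (nat \<times> nat) set" where
  "pattern_index n = {(i, j). i \<in> {1..2*n} \<and> j \<in> {1..(i + 1) div 2}}"

definition odd_ends :: "nat \<Rightarrow> (nat \<times> nat) set" where
  "odd_ends n = {(2*i - 1, i) | i. i \<in> {1..n}}"

text \<open>Patterns of height \<open>2n\<close>; again extensionality makes the representation unique.\<close>

definition split_orthogonal_pattern :: "nat \<Rightarrow> (nat \<times> nat \<Rightarrow> real) \<Rightarrow> bool" where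
  "split_orthogonal_pattern n z \<longleftrightarrow>
     z \<in> extensional (pattern_index n) \<and>
     (\<forall>i j. (i, j) \<in> pattern_index n \<longrightarrow> (i + 1, j + 1) \<in> pattern_index n \<longrightarrow>
        z (i + 1, j + 1) \<le> z (i, j)) \<and>
     (\<forall>i j. (i, j) \<in> pattern_index n \<longrightarrow> (i + 1, j) \<in> pattern_index n \<longrightarrow>
        z (i, j) \<le> z (i + 1, j)) \<and>
     (\<forall>e\<in>odd_ends n. 2 * z e \<in> \<nat>) \<and>
     ((\<forall>e\<in>pattern_index n - odd_ends n. z e \<in> \<int> \<and> 0 \<le> z e) \<or>
      (\<forall>e\<in>pattern_index n - odd_ends n. z e \<in> half_integers \<and> 0 \<le> z e))"

definition patterns_of_shape :: "nat \<Rightarrow> (nat \<Rightarrow> real) \<Rightarrow> (nat \<times> nat \<Rightarrow> real) set" where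
  "patterns_of_shape n lam =
     {z. split_orthogonal_pattern n z \<and> (\<forall>j\<in>{1..n}. z (2*n, j) = lam j)}"

definition pattern_type :: "(nat \<times> nat \<Rightarrow> real) \<Rightarrow> nat \<Rightarrow> real" where
  "pattern_type z i =
     (\<Sum>j = 1..(i + 1) div 2. z (i, j)) - (\<Sum>j = 1..i div 2. z (i - 1, j))"

definition atypical_entries :: "nat \<Rightarrow> (nat \<times> nat \<Rightarrow> real) \<Rightarrow> (nat \<times> nat) set" where
  "atypical_entries n z =
     (if z (2*n, 1) \<in> \<int> then {e \<in> pattern_index n. z e \<in> half_integers}
      else {e \<in> pattern_index n. z e \<in> \<int>})"

text \<open>The exponents of the variables lie in \<open>\<int>\<close> or in \<open>1/2 + \<int>\<close> and may be negative,
  hence \<open>powr\<close>; the function is meant for positive \<open>x 1, \<dots>, x n\<close>.\<close>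

definition schur_CB :: "nat \<Rightarrow> (nat \<Rightarrow> real) \<Rightarrow> (nat \<Rightarrow> real) \<Rightarrow> real \<Rightarrow> real" where
  "schur_CB n lam x \<beta> =
     (\<Sum>z\<in>patterns_of_shape n lam. \<beta> ^ card (atypical_entries n z) *
        (\<Prod>i = 1..n. x i powr (pattern_type z (2*i) - pattern_type z (2*i - 1))))"

end

theory Submission
  imports Defs
begin

text \<open>By symmetry about both diagonals, \<open>L(2n, 2n) \<le> 2u\<close> is a condition on the half-space
  passage times \<open>t\<close> to the antidiagonal, computed from the weights in the triangle
  \<open>i \<le> j \<le> 2n + 1 - i\<close> with the antidiagonal ones halved.  The RSK correspondence, performed box by
  box through local moves (toggle the diagonal behind the new box between its lower and upper
  bounds, then add the weight), maps nonnegative arrays on this triangle bijectively to nonnegative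
  arrays \<open>t\<close> increasing along rows and columns, so that the entries on the antidiagonal become the
  passage times.  The sum of \<open>t\<close> along the diagonal through a border box is the total weight of the
  symmetrized rectangle spanned by it, and the alternating sum along the main diagonal is the total
  weight on that diagonal; these identities turn the product of the laws of the weights into
  the monomial of a pattern times a power of \<open>\<alpha>\<close>.  Finally \<open>z\<^bsub>k,a\<^esub> = u - t\<^bsub>a,a+2n-k\<^esub>\<close> is a split
  orthogonal pattern whose shape \<open>\<lambda>\<close> lies in \<open>u\<^sup>n\<close>.  Its atypical entries are the odd ends that come
  from odd antidiagonal weights.\<close>

subsection \<open>Local moves on weakly increasing arrays\<close>

text \<open>A path between the corners meets the antidiagonal once, and by reflection what lies
  before it counts twice. Hence the halved weights, and in doubled units a passage time to the
  antidiagonal is an even number plus the weight itself, so the factor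
  \<open>\<beta> ^ (k mod 2)\<close> can be read off the output. The correspondence is controlled by
  three quantities at the border boxes alone: passage time, diagonal sum, alternating sum. A local
  move closes on them because the maximum and the minimum of two neighbours add up to their sum. The
  constant in front of the probability is the reciprocal of the product of the normalising factors
  of the laws; a pair \<open>i < j \<le> n\<close> of variables is met by two boxes of the triangle,
  hence the square. The power \<open>u\<close> of the product of the \<open>p i\<close> comes from
  the complement: rows \<open>2*i\<close>, \<open>2*i - 1\<close>, \<open>2*i - 2\<close> of a
  pattern have \<open>i\<close>, \<open>i\<close>, \<open>i - 1\<close> entries and enter the
  exponent of \<open>p i\<close> with coefficients 1, -2, 1, so that the shifts by \<open>u\<close>
  add up to \<open>- u\<close>.\<close>

definition triangle :: "nat \<Rightarrow> (nat \<times> nat) set" where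
  "triangle N = {(i, j). 1 \<le> i \<and> i \<le> j \<and> i + j \<le> N}"

definition order_ideal :: "(nat \<times> nat) set \<Rightarrow> bool" where
  "order_ideal L \<longleftrightarrow>
     (\<forall>i j a b. (i, j) \<in> L \<longrightarrow> 1 \<le> a \<longrightarrow> a \<le> i \<longrightarrow> a \<le> b \<longrightarrow> b \<le> j \<longrightarrow> (a, b) \<in> L)"

text \<open>The cases \<open>i = j\<close> come from extending \<open>f\<close> symmetrically across the diagonal.\<close>

definition lo :: "(nat \<times> nat \<Rightarrow> int) \<Rightarrow> nat \<Rightarrow> nat \<Rightarrow> int" where
  "lo f i j = (if i < j then max (f (i - 1, j)) (f (i, j - 1)) else f (i - 1, j))"

definition hi :: "(nat \<times> nat \<Rightarrow> int) \<Rightarrow> nat \<Rightarrow> nat \<Rightarrow> int" where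
  "hi f i j = (if i < j then min (f (i + 1, j)) (f (i, j + 1)) else f (i, j + 1))"

text \<open>Everything is doubled to stay within the integers: weights and array entries strictly before
  the antidiagonal \<open>i + j = N\<close> are even, while entries on it (standing for halved weights) are
  arbitrary.  Row \<open>0\<close> lies outside of the triangle and supplies the boundary value \<open>0\<close>.  The array is
  increasing on the part \<open>L\<close> that has been processed; elsewhere it still holds the weights.\<close>

definition arrays :: "nat \<Rightarrow> (nat \<times> nat) set \<Rightarrow> (nat \<times> nat \<Rightarrow> int) set" where
  "arrays N L = {f. (\<forall>x. x \<notin> triangle N \<longrightarrow> f x = 0) \<and> (\<forall>x. 0 \<le> f x) \<and>
     (\<forall>x\<in>triangle (N - 1). even (f x)) \<and> (\<forall>(i, j)\<in>L. lo f i j \<le> f (i, j))}"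

definition local_move :: "nat \<Rightarrow> nat \<Rightarrow> (nat \<times> nat \<Rightarrow> int) \<Rightarrow> nat \<times> nat \<Rightarrow> int" where
  "local_move i j f = (\<lambda>(a, b).
     if a + j = b + i \<and> 1 \<le> a \<and> a < i then lo f a b + hi f a b - f (a, b)
     else if a = i \<and> b = j then f (i, j) + lo f i j else f (a, b))"

definition local_unmove :: "nat \<Rightarrow> nat \<Rightarrow> (nat \<times> nat \<Rightarrow> int) \<Rightarrow> nat \<times> nat \<Rightarrow> int" where
  "local_unmove i j f = (\<lambda>(a, b).
     if a + j = b + i \<and> 1 \<le> a \<and> a < i then lo f a b + hi f a b - f (a, b)
     else if a = i \<and> b = j then f (i, j) - lo f i j else f (a, b))"

text \<open>The neighbours of a box lie on adjacent diagonals, which a move leaves unchanged.\<close>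

lemma lo_hi_off_diagonal:
  assumes "\<And>c d. c + j \<noteq> d + i \<Longrightarrow> g (c, d) = f (c, d)" "a + j = b + i" "1 \<le> a" "a \<le> b"
  shows "lo g a b = lo f a b" "hi g a b = hi f a b"
proof -
  have "g (a - 1, b) = f (a - 1, b)" "g (a, b - 1) = f (a, b - 1)"
    "g (a + 1, b) = f (a + 1, b)" "g (a, b + 1) = f (a, b + 1)"
    using assms(2-4) by (intro assms(1); linarith)+
  then show "lo g a b = lo f a b" "hi g a b = hi f a b"
    by (simp_all add: lo_def hi_def)
qed

lemma lo_hi_local_move:
  assumes "a + j = b + i" "1 \<le> a" "a \<le> b"
  shows "lo (local_move i j f) a b = lo f a b" "hi (local_move i j f) a b = hi f a b"
    "lo (local_unmove i j f) a b = lo f a b" "hi (local_unmove i j f) a b = hi f a b"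
  by (rule lo_hi_off_diagonal[OF _ assms];
      auto simp: local_move_def local_unmove_def)+

text \<open>The toggle \<open>lo + hi - f\<close> is an involution because it changes neither
  \<open>lo\<close> nor \<open>hi\<close> on its diagonal; at the corner the two moves add and
  subtract the same \<open>lo\<close>.\<close>

lemma local_move_inverse:
  assumes "1 \<le> i" "i \<le> j"
  shows "local_unmove i j (local_move i j f) = f" "local_move i j (local_unmove i j f) = f"
proof -
  have "local_unmove i j (local_move i j f) (a, b) = f (a, b)" for a b
    unfolding local_unmove_def[of i j "local_move i j f"]
    using assms by (auto simp: lo_hi_local_move) (auto simp: local_move_def)
  then show "local_unmove i j (local_move i j f) = f" by auto
  have "local_move i j (local_unmove i j f) (a, b) = f (a, b)" for a b
    unfolding local_move_def[of i j "local_unmove i j f"]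
    using assms by (auto simp: lo_hi_local_move) (auto simp: local_unmove_def)
  then show "local_move i j (local_unmove i j f) = f" by auto
qed

lemma order_idealD:
  "order_ideal L \<Longrightarrow> (i, j) \<in> L \<Longrightarrow> 1 \<le> a \<Longrightarrow> a \<le> i \<Longrightarrow> a \<le> b \<Longrightarrow> b \<le> j \<Longrightarrow> (a, b) \<in> L"
  unfolding order_ideal_def by blast

text \<open>The successors of a box on the diagonal behind the corner \<open>(i, j)\<close> already
  lie in \<open>L\<close>, and their inequalities bound \<open>f (a, b)\<close> from above. So the
  toggle reflects a point within an interval that contains it.\<close>

lemma arrays_le_hi:
  assumes f: "f \<in> arrays N L" and L: "order_ideal L"
    and "(i, j) \<notin> L" "order_ideal (insert (i, j) L)" "a + j = b + i" "1 \<le> a" "a < i" "i \<le> j"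
  shows "f (a, b) \<le> hi f a b" "lo f a b \<le> f (a, b)"
proof -
  have mem: "(c, d) \<in> L" if "1 \<le> c" "c \<le> d" "c \<le> i" "d \<le> j" "(c, d) \<noteq> (i, j)" for c d
    using order_idealD[OF assms(4), of i j c d] that by auto
  have lo: "lo f c d \<le> f (c, d)" if "1 \<le> c" "c \<le> d" "c \<le> i" "d \<le> j" "(c, d) \<noteq> (i, j)" for c d
    using f mem[OF that] unfolding arrays_def by auto
  have ab: "b < j" "a \<le> b" using assms by auto
  have right: "f (a, b) \<le> f (a, b + 1)"
    using lo[of a "b + 1"] assms ab by (auto simp: lo_def)
  have "f (a, b) \<le> f (a + 1, b)" if "a < b"
    using lo[of "a + 1" b] assms that ab by (auto simp: lo_def split: if_splits)
  then show "f (a, b) \<le> hi f a b" using right by (auto simp: hi_def)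
  show "lo f a b \<le> f (a, b)" using lo[of a b] assms ab by auto
qed

text \<open>\<open>hi\<close> looks one level beyond \<open>(a, b)\<close>, and level
  \<open>N\<close> may hold odd values; hence the stronger bound for \<open>hi\<close>.\<close>

lemma even_lo_hi:
  assumes f: "f \<in> arrays N L" and "a + b \<le> N" "1 \<le> a" "a \<le> b"
  shows "even (lo f a b)" "a + b + 2 \<le> N \<Longrightarrow> even (hi f a b)"
proof -
  have ev: "even (f (c, d))" if "c + d \<le> N - 1" for c d
  proof (cases "(c, d) \<in> triangle (N - 1)")
    case True then show ?thesis using f by (auto simp: arrays_def)
  next
    case False
    then have "(c, d) \<notin> triangle N" using that by (auto simp: triangle_def)
    then show ?thesis using f by (auto simp: arrays_def)
  qed
  have "even (f (a - 1, b))" "even (f (a, b - 1))"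
    using assms by (auto intro!: ev)
  then show "even (lo f a b)" by (auto simp: lo_def max_def)
  assume "a + b + 2 \<le> N"
  then have "even (f (a + 1, b))" "even (f (a, b + 1))"
    by (auto intro!: ev)
  then show "even (hi f a b)" by (auto simp: hi_def min_def)
qed

text \<open>Serves the move and its inverse at once: they differ only in the value at the corner, of
  which just sign and parity are assumed. A reflected entry stays between \<open>lo\<close> and
  \<open>hi\<close>, and these bounds imply every inequality in \<open>L\<close> that involves
  it.\<close>

lemma reflect_arrays:
  assumes f: "f \<in> arrays N L" and L: "order_ideal L" "L \<subseteq> triangle N"
    and ij: "(i, j) \<in> triangle N" "(i, j) \<notin> L" "order_ideal (insert (i, j) L)"
    and off: "\<And>a b. \<not> (a + j = b + i \<and> 1 \<le> a \<and> a \<le> i) \<Longrightarrow> g (a, b) = f (a, b)"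
    and refl: "\<And>a b. a + j = b + i \<Longrightarrow> 1 \<le> a \<Longrightarrow> a < i \<Longrightarrow> g (a, b) = lo f a b + hi f a b - f (a, b)"
    and corner: "0 \<le> g (i, j)" "i + j < N \<Longrightarrow> even (g (i, j))"
  shows "g \<in> arrays N L"
proof -
  have "1 \<le> i" "i \<le> j" "i + j \<le> N" using ij by (auto simp: triangle_def)
  note bounds = arrays_le_hi[OF f L(1) ij(2,3) _ _ _ \<open>i \<le> j\<close>]
  have nn: "0 \<le> f x" for x using f by (cases x) (auto simp: arrays_def)
  have lo0: "0 \<le> lo f a b" for a b using nn by (auto simp: lo_def max_def)
  have g_between: "lo f a b \<le> g (a, b)" "g (a, b) \<le> hi f a b"
    if "a + j = b + i" "1 \<le> a" "a < i" for a b
    using bounds[OF that] refl[OF that] by auto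
  have 1: "g x = 0" if "x \<notin> triangle N" for x
  proof -
    obtain a b where x: "x = (a, b)" by force
    have "\<not> (a + j = b + i \<and> 1 \<le> a \<and> a \<le> i)"
      using that \<open>i \<le> j\<close> \<open>i + j \<le> N\<close> unfolding x triangle_def by auto
    then show ?thesis using off f that unfolding x arrays_def by auto
  qed
  have 2: "0 \<le> g x" for x
  proof -
    obtain a b where x: "x = (a, b)" by force
    consider "\<not> (a + j = b + i \<and> 1 \<le> a \<and> a \<le> i)" | "a + j = b + i" "1 \<le> a" "a < i" | "x = (i, j)"
      unfolding x by fastforce
    then show ?thesis
      using off[of a b] nn[of "(a, b)"] g_between[of a b] lo0[of a b] corner(1) unfolding x
      by cases auto
  qed
  have 3: "even (g x)" if "x \<in> triangle (N - 1)" for x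
  proof -
    obtain a b where x: "x = (a, b)" by force
    have ab: "a \<le> b" "1 \<le> a" "a + b \<le> N - 1" using that by (auto simp: x triangle_def)
    have evf: "even (f (a, b))" using f that by (auto simp: arrays_def x)
    consider "\<not> (a + j = b + i \<and> 1 \<le> a \<and> a \<le> i)" | "a + j = b + i" "1 \<le> a" "a < i" | "x = (i, j)"
      unfolding x by fastforce
    then show ?thesis
    proof cases
      case 2
      \<comment> \<open>A box strictly behind the corner is at least two levels lower, so all
        entries used by its toggle are even.\<close>
      have "a + b + 2 \<le> N" using 2 \<open>i + j \<le> N\<close> by auto
      then show ?thesis using even_lo_hi[OF f _ _ ab(1)] refl[OF 2] evf ab by (auto simp: x)
    qed (use evf off corner ab \<open>1 \<le> i\<close> \<open>i \<le> j\<close> in \<open>auto simp: x\<close>)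
  qed
  have 4: "lo g a b \<le> g (a, b)" if "(a, b) \<in> L" for a b
  proof -
    have ab: "a \<le> b" "1 \<le> a" using that L(2) by (auto simp: triangle_def)
    \<comment> \<open>Since \<open>(i, j)\<close> is not in \<open>L\<close>, no box of
      \<open>L\<close> lies beyond it, and the value at the corner is never compared within
      \<open>L\<close>.\<close>
    have nle: "\<not> (i \<le> a \<and> j \<le> b)"
      using order_idealD[OF L(1) that, of i j] \<open>1 \<le> i\<close> \<open>i \<le> j\<close> ij(2) by auto
    show ?thesis
    proof (cases "a + j = b + i")
      case True
      then have "a < i" using nle by auto
      have "lo g a b = lo f a b"
        by (rule lo_hi_off_diagonal[OF _ True ab(2,1)]) (use off in auto)
      then show ?thesis using g_between[OF True ab(2) \<open>a < i\<close>] by simp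
    next
      case False
      have gf: "g (a, b) = f (a, b)" using off False by auto
      have lof: "lo f a b \<le> f (a, b)" using f that by (auto simp: arrays_def)
      have up: "g (a - 1, b) \<le> f (a, b)"
      proof (cases "a - 1 + j = b + i \<and> 1 \<le> a - 1 \<and> a - 1 \<le> i")
        case True
        then have "a - 1 < i" using nle by auto
        then have "g (a - 1, b) \<le> hi f (a - 1) b" using g_between True by auto
        also have "\<dots> \<le> f (a, b)" using ab True by (auto simp: hi_def)
        finally show ?thesis .
      next
        case False
        then show ?thesis using off lof by (auto simp: lo_def split: if_splits)
      qed
      have left: "g (a, b - 1) \<le> f (a, b)" if "a < b"
      proof (cases "a + j = b - 1 + i \<and> 1 \<le> a \<and> a \<le> i")
        case True
        then have "a < i" using nle that by (cases "a = i") auto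
        then have "g (a, b - 1) \<le> hi f a (b - 1)" using g_between True by auto
        also have "\<dots> \<le> f (a, b)" using ab that by (auto simp: hi_def)
        finally show ?thesis .
      next
        case False
        then show ?thesis using off lof that by (auto simp: lo_def split: if_splits)
      qed
      show ?thesis using up left gf by (auto simp: lo_def)
    qed
  qed
  show ?thesis using 1 2 3 4 by (auto simp: arrays_def)
qed

text \<open>Adding \<open>lo\<close> at the corner turns the condition
  \<open>0 \<le> f (i, j)\<close> on a weight into the new inequality
  \<open>lo f i j \<le> f (i, j)\<close>; subtracting it turns it back.\<close>

lemma bij_betw_local_move:
  assumes L: "order_ideal L" "L \<subseteq> triangle N"
    and ij: "(i, j) \<in> triangle N" "(i, j) \<notin> L" "order_ideal (insert (i, j) L)"
  shows "bij_betw (local_move i j) (arrays N L) (arrays N (insert (i, j) L))"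
proof (rule bij_betw_byWitness)
  have bounds: "1 \<le> i" "i \<le> j" "i + j \<le> N" using ij by (auto simp: triangle_def)
  have lo0: "0 \<le> lo f a b" if "f \<in> arrays N L'" for f a b L'
    using that by (auto simp: lo_def max_def arrays_def)
  have evf: "even (f (i, j))" if "f \<in> arrays N L'" "i + j < N" for f L'
    using that bounds by (auto simp: arrays_def triangle_def)
  show "\<forall>f\<in>arrays N L. local_unmove i j (local_move i j f) = f"
    "\<forall>f\<in>arrays N (insert (i, j) L). local_move i j (local_unmove i j f) = f"
    using local_move_inverse bounds by auto
  show "local_move i j ` arrays N L \<subseteq> arrays N (insert (i, j) L)"
  proof clarify
    fix f assume f: "f \<in> arrays N L"
    have eq: "local_move i j f (i, j) = f (i, j) + lo f i j" by (simp add: local_move_def)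
    have "0 \<le> f (i, j)" using f by (auto simp: arrays_def)
    have "local_move i j f \<in> arrays N L"
    proof (rule reflect_arrays[OF f L ij])
      show "0 \<le> local_move i j f (i, j)" unfolding eq using lo0[OF f] \<open>0 \<le> f (i, j)\<close> by simp
      show "even (local_move i j f (i, j))" if "i + j < N"
        unfolding eq using evf[OF f that] even_lo_hi(1)[OF f bounds(3,1,2)] by simp
    qed (use bounds in \<open>auto simp: local_move_def\<close>)
    moreover have "lo (local_move i j f) i j \<le> local_move i j f (i, j)"
      unfolding eq using lo_hi_local_move(1)[of i j j i f] bounds \<open>0 \<le> f (i, j)\<close> by simp
    ultimately show "local_move i j f \<in> arrays N (insert (i, j) L)"
      by (simp add: arrays_def)
  qed
  show "local_unmove i j ` arrays N (insert (i, j) L) \<subseteq> arrays N L"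
  proof clarify
    fix f assume f': "f \<in> arrays N (insert (i, j) L)"
    then have f: "f \<in> arrays N L" by (auto simp: arrays_def)
    have eq: "local_unmove i j f (i, j) = f (i, j) - lo f i j" by (simp add: local_unmove_def)
    have "lo f i j \<le> f (i, j)" using f' by (auto simp: arrays_def)
    show "local_unmove i j f \<in> arrays N L"
    proof (rule reflect_arrays[OF f L ij])
      show "0 \<le> local_unmove i j f (i, j)" unfolding eq using \<open>lo f i j \<le> f (i, j)\<close> by simp
      show "even (local_unmove i j f (i, j))" if "i + j < N"
        unfolding eq using evf[OF f that] even_lo_hi(1)[OF f bounds(3,1,2)] by simp
    qed (use bounds in \<open>auto simp: local_unmove_def\<close>)
  qed
qed

subsection \<open>The bijection from weights to arrays and its border invariants\<close>

text \<open>The type is left open: natural numbers for the given weights, integers for the doubled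
  ones. The boundary value 0 stands for the absence of a path, which is correct in a maximum when
  weights are nonnegative.\<close>

fun lpp :: "(nat \<times> nat \<Rightarrow> 'a::linordered_semidom) \<Rightarrow> nat \<Rightarrow> nat \<Rightarrow> 'a" where
  "lpp w 0 j = 0"
| "lpp w (Suc i) 0 = 0"
| "lpp w (Suc i) (Suc j) = max (lpp w i (Suc j)) (lpp w (Suc i) j) + w (Suc i, Suc j)"

definition symmetrize :: "(nat \<times> nat \<Rightarrow> 'a) \<Rightarrow> nat \<times> nat \<Rightarrow> 'a" where
  "symmetrize w = (\<lambda>(i, j). w (min i j, max i j))"

lemma lpp_0_right [simp]: "lpp w i 0 = 0"
  by (cases i) auto

lemma lpp_transpose:
  assumes "\<And>a b. a \<in> {1..i} \<Longrightarrow> b \<in> {1..j} \<Longrightarrow> w (a, b) = w' (b, a)"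
  shows "lpp w i j = lpp w' j i"
  using assms
proof (induction w i j rule: lpp.induct)
  case (3 w i j)
  have "lpp w i (Suc j) = lpp w' (Suc j) i" "lpp w (Suc i) j = lpp w' j (Suc i)"
    using 3 by auto
  then show ?case using 3(3)[of "Suc i" "Suc j"] by (simp add: max.commute)
qed auto

lemma symmetrize_sym: "symmetrize w (i, j) = symmetrize w (j, i)"
  by (simp add: symmetrize_def min.commute max.commute)

definition rect :: "(nat \<times> nat \<Rightarrow> int) \<Rightarrow> nat \<Rightarrow> nat \<Rightarrow> int" where
  "rect w i j = (\<Sum>a = 1..i. \<Sum>b = 1..j. symmetrize w (a, b))"

lemma rect_Suc:
  "rect w (Suc i) (Suc j) + rect w i j =
     rect w i (Suc j) + rect w (Suc i) j + symmetrize w (Suc i, Suc j)"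
  by (simp add: rect_def sum.distrib)

lemma rect_sym: "rect w i j = rect w j i"
  unfolding rect_def by (subst sum.swap) (simp add: symmetrize_sym)

text \<open>In terms of RSK for the symmetrized rectangle, the diagonal through
  \<open>(i, j)\<close> holds the parts of the shape. The clauses record its first part, its size
  and, for a symmetric square, the alternating sum of its parts, which counts odd columns and equals
  the trace.\<close>

definition border_inv :: "(nat \<times> nat \<Rightarrow> int) \<Rightarrow> (nat \<times> nat \<Rightarrow> int) \<Rightarrow> nat \<Rightarrow> nat \<Rightarrow> bool" where
  "border_inv w f i j \<longleftrightarrow> f (i, j) = lpp (symmetrize w) i j \<and>
     (\<Sum>a = 1..i. f (a, a + (j - i))) = rect w i j \<and>
     (i = j \<longrightarrow> (\<Sum>a = 1..i. (- 1) ^ (i + a) * f (a, a)) = (\<Sum>a = 1..i. w (a, a)))"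

text \<open>\<open>lo\<close> at a box and \<open>hi\<close> at the preceding box of the diagonal
  are the maximum and the minimum of the same two entries, so each such pair adds up to entries of
  the adjacent diagonals. For \<open>d = 0\<close> both are the same entry, hence the factor
  2.\<close>

lemma diagonal_sum_lo_hi:
  assumes "\<And>j. f (0, j) = 0" "\<And>x. 0 \<le> f x"
  shows "(\<Sum>a = 1..Suc m. lo f a (a + d)) + (\<Sum>a = 1..m. hi f a (a + d)) =
    (if d = 0 then 2 * (\<Sum>a = 1..m. f (a, a + 1))
     else (\<Sum>a = 1..m. f (a, a + (d + 1))) + (\<Sum>a = 1..Suc m. f (a, a + (d - 1))))"
proof (induction m)
  case 0
  then show ?case using assms(1) assms(2)[of "(1, d)"] by (auto simp: lo_def)
next
  case (Suc m)
  have "lo f (Suc (Suc m)) (Suc (Suc m) + d) + hi f (Suc m) (Suc m + d) =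
    (if d = 0 then 2 * f (Suc m, Suc m + 1)
     else f (Suc m, Suc m + (d + 1)) + f (Suc (Suc m), Suc (Suc m) + (d - 1)))"
    by (auto simp: lo_def hi_def max_def min_def)
  then show ?case
    using Suc.IH by (cases "d = 0") (auto simp: algebra_simps)
qed

text \<open>On the main diagonal \<open>lo + hi\<close> is the sum of two consecutive entries of the
  next diagonal. With alternating signs only the last entry survives, and it cancels the
  \<open>lo\<close> added at the new corner.\<close>

lemma alternating_telescope:
  fixes g :: "nat \<Rightarrow> int"
  assumes "g 0 = 0"
  shows "(\<Sum>a = 1..m. (- 1) ^ (Suc m + a) * (g (a - 1) + g a)) = - g m"
proof (induction m)
  case (Suc m)
  have "(\<Sum>a = 1..m. (- 1) ^ (Suc (Suc m) + a) * (g (a - 1) + g a)) =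
     - (\<Sum>a = 1..m. (- 1) ^ (Suc m + a) * (g (a - 1) + g a))"
    by (simp add: sum_negf[symmetric])
  then show ?case using Suc.IH by simp
qed (use assms in auto)

lemma border_inv_local_move:
  assumes f: "\<And>j. f (0, j) = 0" "\<And>x. 0 \<le> f x" and "i \<le> j"
    and up: "border_inv w f i (Suc j)"
    and left: "i < j \<Longrightarrow> border_inv w f (Suc i) j"
    and diag: "border_inv w f i j"
    and corner: "f (Suc i, Suc j) = w (Suc i, Suc j)"
  shows "border_inv w (local_move (Suc i) (Suc j) f) (Suc i) (Suc j)"
proof -
  define d where "d = j - i"
  let ?g = "local_move (Suc i) (Suc j) f"
  have j: "j = i + d" using assms by (simp add: d_def)
  have sw: "symmetrize w (Suc i, Suc j) = w (Suc i, Suc j)"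
    using \<open>i \<le> j\<close> by (simp add: symmetrize_def)
  have gc: "?g (Suc i, Suc j) = w (Suc i, Suc j) + lo f (Suc i) (Suc j)"
    by (simp add: local_move_def corner)
  have gd: "?g (a, a + d) = lo f a (a + d) + hi f a (a + d) - f (a, a + d)" if "1 \<le> a" "a \<le> i" for a
    using that by (simp add: local_move_def j)
  have 1: "?g (Suc i, Suc j) = lpp (symmetrize w) (Suc i) (Suc j)"
  proof (cases "i < j")
    case True
    then show ?thesis using up left gc sw by (simp add: lo_def border_inv_def)
  next
    case False
    then have "i = j" using \<open>i \<le> j\<close> by simp
    \<comment> \<open>On the main diagonal the left neighbour is the mirror image of the upper
      one.\<close>
    then show ?thesis using up gc sw lpp_transpose[of "Suc j" j "symmetrize w", OF symmetrize_sym]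
      by (simp add: lo_def border_inv_def)
  qed
  have "(\<Sum>a = 1..Suc i. ?g (a, a + d)) =
      (\<Sum>a = 1..i. lo f a (a + d) + hi f a (a + d) - f (a, a + d)) + ?g (Suc i, Suc j)"
    using gd by (simp add: j)
  also have "\<dots> = ((\<Sum>a = 1..Suc i. lo f a (a + d)) + (\<Sum>a = 1..i. hi f a (a + d)))
      - (\<Sum>a = 1..i. f (a, a + d)) + w (Suc i, Suc j)"
    unfolding gc by (simp add: sum.distrib sum_subtractf j)
  \<comment> \<open>Inclusion-exclusion for rectangles: the adjacent diagonals are evaluated by
    \<open>up\<close> and \<open>left\<close>, the old values by \<open>diag\<close>. For
    \<open>d = 0\<close> the rectangle of \<open>up\<close> counts twice, once transposed.\<close>
  also have "\<dots> = rect w (Suc i) (Suc j)"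
  proof (cases "d = 0")
    case True
    then show ?thesis unfolding diagonal_sum_lo_hi[of f, OF f(1) f(2)]
      using up diag rect_Suc[of w i j] rect_sym[of w "Suc i" i] sw by (simp add: border_inv_def j)
  next
    case False
    then obtain e where e: "d = Suc e" by (cases d) auto
    show ?thesis unfolding diagonal_sum_lo_hi[of f, OF f(1) f(2)]
      using up left diag rect_Suc[of w i j] sw by (simp add: border_inv_def j e)
  qed
  finally have 2: "(\<Sum>a = 1..Suc i. ?g (a, a + d)) = rect w (Suc i) (Suc j)" .
  have 3: "(\<Sum>a = 1..Suc i. (- 1) ^ (Suc i + a) * ?g (a, a)) = (\<Sum>a = 1..Suc i. w (a, a))"
    if "i = j"
  proof -
    have "d = 0" using that j by simp
    have *: "(- 1) ^ (Suc i + a) * ?g (a, a) =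
      (- 1) ^ (Suc i + a) * (f (a - 1, Suc (a - 1)) + f (a, Suc a)) + (- 1) ^ (i + a) * f (a, a)"
      if "a \<in> {1..i}" for a
    proof -
      have "?g (a, a) = f (a - 1, Suc (a - 1)) + f (a, Suc a) - f (a, a)"
        using gd[of a] that \<open>d = 0\<close> by (simp add: lo_def hi_def)
      then show ?thesis by (simp only: ring_distribs power_Suc add_Suc)
    qed
    have "(\<Sum>a = 1..i. (- 1) ^ (Suc i + a) * ?g (a, a)) =
       (\<Sum>a = 1..i. (- 1) ^ (Suc i + a) * (f (a - 1, Suc (a - 1)) + f (a, Suc a)))
       + (\<Sum>a = 1..i. (- 1) ^ (i + a) * f (a, a))"
      unfolding sum.distrib[symmetric] by (rule sum.cong[OF refl *])
    also have "\<dots> = - f (i, Suc i) + (\<Sum>a = 1..i. w (a, a))"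
      using alternating_telescope[of "\<lambda>a. f (a, Suc a)" i] f(1) diag that
      by (simp add: border_inv_def)
    finally show ?thesis using gc that by (simp add: lo_def)
  qed
  show ?thesis unfolding border_inv_def using 1 2 3 by (simp add: d_def)
qed

lemma border_inv_0:
  assumes "\<And>j. f (0, j) = 0"
  shows "border_inv w f 0 j"
  using assms by (simp add: border_inv_def rect_def)

text \<open>The boxes enter one at a time. Unprocessed boxes keep their weights, so the next corner
  is known to hold its value of \<open>w\<close>. The invariant is claimed on the border only,
  because the diagonal of any other box has been toggled again by a later corner.\<close>

lemma RSK_bijection:
  assumes "finite L" "order_ideal L" "L \<subseteq> triangle N"
  shows "\<exists>\<Phi>. bij_betw \<Phi> (arrays N {}) (arrays N L) \<and>
    (\<forall>w\<in>arrays N {}. (\<forall>x. x \<notin> L \<longrightarrow> \<Phi> w x = w x) \<and>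
       (\<forall>i j. (i, j) \<in> L \<longrightarrow> (Suc i, Suc j) \<notin> L \<longrightarrow> border_inv w (\<Phi> w) i j))"
  using assms
proof (induction "card L" arbitrary: L)
  case 0
  then have "L = {}" by simp
  then show ?case by (intro exI[of _ id]) (auto simp: bij_betw_id[unfolded id_def])
next
  case (Suc k L)
  have "L \<noteq> {}" using Suc.hyps by auto
  \<comment> \<open>Removing a box of maximal level leaves an order ideal \<open>K\<close>. As no
    box of \<open>L\<close> lies beyond it, its upper, left and diagonal predecessors are border
    boxes of \<open>K\<close>, or lie in row 0.\<close>
  define M where "M = Max ((\<lambda>(i, j). i + j) ` L)"
  have "M \<in> (\<lambda>(i, j). i + j) ` L"
    unfolding M_def using Suc.prems(1) \<open>L \<noteq> {}\<close> by (intro Max_in) auto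
  then obtain i' j' where ij': "(i', j') \<in> L" "i' + j' = M" by auto
  have maximal: "a + b \<le> i' + j'" if "(a, b) \<in> L" for a b
    unfolding ij'(2) M_def using Suc.prems(1) that by (intro Max_ge) force+
  have T: "(i', j') \<in> triangle N" using Suc.prems(3) ij' by auto
  then obtain i j where ij: "i' = Suc i" "j' = Suc j" "i \<le> j"
    by (cases i'; cases j') (auto simp: triangle_def)
  define K where "K = L - {(i', j')}"
  have LK: "L = insert (i', j') K" "(i', j') \<notin> K" using ij' by (auto simp: K_def)
  have K: "finite K" "K \<subseteq> triangle N" "card K = k"
    using Suc.prems Suc.hyps(2) ij' by (auto simp: K_def)
  have "order_ideal K"
    unfolding order_ideal_def
  proof (intro allI impI)
    fix c d a b assume *: "(c, d) \<in> K" "1 \<le> a" "a \<le> c" "a \<le> b" "b \<le> d"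
    have "(c, d) \<in> L" "(c, d) \<noteq> (i', j')" using * by (auto simp: K_def)
    moreover have "(a, b) \<in> L" using order_idealD[OF Suc.prems(2) \<open>(c, d) \<in> L\<close>] * by auto
    moreover have "(a, b) \<noteq> (i', j')" using maximal[OF \<open>(c, d) \<in> L\<close>] * \<open>(c, d) \<noteq> (i', j')\<close> by auto
    ultimately show "(a, b) \<in> K" by (simp add: K_def)
  qed
  from Suc.hyps(1)[OF K(3)[symmetric] K(1) this K(2)] obtain \<Phi> where
    \<Phi>: "bij_betw \<Phi> (arrays N {}) (arrays N K)"
    "\<And>w x. w \<in> arrays N {} \<Longrightarrow> x \<notin> K \<Longrightarrow> \<Phi> w x = w x"
    "\<And>w i j. w \<in> arrays N {} \<Longrightarrow> (i, j) \<in> K \<Longrightarrow> (Suc i, Suc j) \<notin> K \<Longrightarrow> border_inv w (\<Phi> w) i j"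
    by blast
  have mv: "bij_betw (local_move i' j') (arrays N K) (arrays N L)"
    unfolding LK(1)
    by (rule bij_betw_local_move) (use \<open>order_ideal K\<close> K T LK Suc.prems in auto)
  show ?case
  proof (intro exI[of _ "local_move i' j' \<circ> \<Phi>"] conjI ballI allI impI)
    show "bij_betw (local_move i' j' \<circ> \<Phi>) (arrays N {}) (arrays N L)"
      by (rule bij_betw_trans[OF \<Phi>(1) mv])
  next
    fix w x assume w: "w \<in> arrays N {}" and x: "x \<notin> L"
    obtain a b where ab: "x = (a, b)" by force
    have "\<not> (a + j' = b + i' \<and> 1 \<le> a \<and> a \<le> i')"
      using order_idealD[OF Suc.prems(2) ij'(1), of a b] x ab ij by auto
    then have "local_move i' j' (\<Phi> w) x = \<Phi> w x" using ij by (auto simp: local_move_def ab)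
    then show "(local_move i' j' \<circ> \<Phi>) w x = w x"
      using \<Phi>(2)[OF w, of x] x LK by auto
  next
    fix w a b assume w: "w \<in> arrays N {}" and ab: "(a, b) \<in> L" "(Suc a, Suc b) \<notin> L"
    define f where "f = \<Phi> w"
    have "f \<in> arrays N K" using \<Phi>(1) w unfolding f_def by (rule bij_betwE[THEN bspec])
    then have f: "\<And>j. f (0, j) = 0" "\<And>x. 0 \<le> f x"
      unfolding arrays_def by (auto simp: triangle_def)
    \<comment> \<open>In row 0 the invariant is trivial; this supplies the predecessors of a corner
      in the first row.\<close>
    have inv: "border_inv w f c d"
      if "c = 0 \<or> (c, d) \<in> K" "(Suc c, Suc d) \<notin> K" for c d
      using that \<Phi>(3)[OF w, folded f_def] border_inv_0[of f, OF f(1)] by (cases c) auto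
    have K_mem: "(c, d) \<in> K" if "1 \<le> c" "c \<le> i'" "c \<le> d" "d \<le> j'" "(c, d) \<noteq> (i', j')" for c d
      using order_idealD[OF Suc.prems(2) ij'(1), of c d] that by (auto simp: K_def)
    have notK: "(c, d) \<notin> K" if "i' \<le> c" "j' \<le> d" for c d
      using maximal[of c d] that by (auto simp: K_def)
    have "border_inv w (local_move i' j' f) a b"
    proof (cases "(a, b) = (i', j')")
      case True
      have "f (i', j') = w (i', j')" unfolding f_def by (rule \<Phi>(2)[OF w LK(2)])
      moreover have "border_inv w f i (Suc j)"
        by (rule inv; cases i; use K_mem[of i "Suc j"] notK ij in auto)
      moreover have "border_inv w f i j"
        by (rule inv; cases i; use K_mem[of i j] notK ij in auto)
      moreover have "border_inv w f (Suc i) j" if "i < j"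
        by (rule inv) (use K_mem[of "Suc i" j] that notK ij in auto)
      ultimately have "border_inv w (local_move (Suc i) (Suc j) f) (Suc i) (Suc j)"
        using f ij by (intro border_inv_local_move) auto
      then show ?thesis using True ij by simp
    next
      case False
      have aT: "1 \<le> a" "a \<le> b" using ab Suc.prems(3) by (auto simp: triangle_def)
      \<comment> \<open>The move changes only the diagonal of \<open>(i', j')\<close>, and no other
        border box is on it: behind the corner, its diagonal successor would lie in
        \<open>L\<close>; beyond the corner, its level would exceed the maximum.\<close>
      have off: "a + j' \<noteq> b + i'"
      proof
        assume eq: "a + j' = b + i'"
        have "a \<noteq> i'" using eq False by auto
        show False
        proof (cases "a < i'")
          case True
          then show False using order_idealD[OF Suc.prems(2) ij'(1), of "Suc a" "Suc b"] ab eq aT by auto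
        next
          case False
          then show False using maximal[OF ab(1)] \<open>a \<noteq> i'\<close> eq by auto
        qed
      qed
      have same: "local_move i' j' f (c, d) = f (c, d)" if "c + b = d + a" for c d
        using off that ij by (auto simp: local_move_def)
      have "border_inv w f a b"
        by (rule inv) (use ab False LK in auto)
      then show ?thesis
        unfolding border_inv_def using aT by (simp add: same)
    qed
    then show "border_inv w ((local_move i' j' \<circ> \<Phi>) w) a b" by (simp add: f_def)
  qed
qed

subsection \<open>Last passage times of doubly symmetric weights\<close>

lemma path_sum_le_lpp:
  fixes w :: "nat \<times> nat \<Rightarrow> nat"
  assumes "\<pi> \<noteq> []" "hd \<pi> = (1, 1)"
    "successively (\<lambda>(i, j) q. q = (i + 1, j) \<or> q = (i, j + 1)) \<pi>"
  shows "(\<Sum>x\<leftarrow>\<pi>. w x) \<le> lpp w (fst (last \<pi>)) (snd (last \<pi>)) \<and> 1 \<le> fst (last \<pi>) \<and> 1 \<le> snd (last \<pi>)"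
  using assms
proof (induction \<pi> rule: rev_induct)
  case (snoc x \<pi>)
  show ?case
  proof (cases "\<pi> = []")
    case True
    then show ?thesis using snoc by auto
  next
    case False
    obtain i j where ij: "last \<pi> = (i, j)" by force
    have x: "x = (i + 1, j) \<or> x = (i, j + 1)"
      using snoc.prems False ij by (auto simp: successively_append_iff)
    have IH: "(\<Sum>x\<leftarrow>\<pi>. w x) \<le> lpp w i j" "1 \<le> i" "1 \<le> j"
      using snoc False ij by (auto simp: successively_append_iff)
    then obtain a b where ab: "i = Suc a" "j = Suc b" by (metis One_nat_def Suc_le_D)
    show ?thesis using IH x unfolding ab by auto
  qed
qed auto

lemma lpp_attained:
  fixes w :: "nat \<times> nat \<Rightarrow> nat"
  shows "1 \<le> k \<Longrightarrow> 1 \<le> l \<Longrightarrow> \<exists>\<pi>\<in>directed_paths (1, 1) (k, l). (\<Sum>x\<leftarrow>\<pi>. w x) = lpp w k l"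
proof (induction w k l rule: lpp.induct)
  case (3 w i j)
  have ext: "\<exists>\<pi>\<in>directed_paths (1, 1) (Suc i, Suc j). (\<Sum>x\<leftarrow>\<pi>. w x) = lpp w a b + w (Suc i, Suc j)"
    if ex: "\<exists>\<pi>\<in>directed_paths (1, 1) (a, b). (\<Sum>x\<leftarrow>\<pi>. w x) = lpp w a b"
      and "(Suc i, Suc j) = (a + 1, b) \<or> (Suc i, Suc j) = (a, b + 1)" for a b
  proof -
    obtain \<pi> where \<pi>: "\<pi> \<in> directed_paths (1, 1) (a, b)" "(\<Sum>x\<leftarrow>\<pi>. w x) = lpp w a b"
      using ex by blast
    have "\<pi> @ [(Suc i, Suc j)] \<in> directed_paths (1, 1) (Suc i, Suc j)"
      using \<pi>(1) that(2) by (auto simp: directed_paths_def successively_append_iff)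
    then show ?thesis using \<pi>(2) by force
  qed
  consider "i = 0" "j = 0" | "0 < i" "lpp w (Suc i) j \<le> lpp w i (Suc j)"
    | "0 < j" "lpp w i (Suc j) \<le> lpp w (Suc i) j"
    by (cases i; cases j; force)
  then show ?case
  proof cases
    case 1
    have "[(1, 1)] \<in> directed_paths (1, 1) (Suc i, Suc j)" by (simp add: directed_paths_def 1)
    then show ?thesis using 1 by (force intro!: bexI[of _ "[(1, 1)]"])
  next
    case 2
    then show ?thesis using ext[of i "Suc j"] 3 by (simp add: max_def)
  next
    case 3
    then show ?thesis using ext[of "Suc i" j] "3.IH" by (simp add: max_def)
  qed
qed auto

lemma last_passage_time_eq_lpp:
  assumes "1 \<le> k" "1 \<le> l"
  shows "last_passage_time w k l = lpp (\<lambda>(i, j). w i j) k l"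
proof -
  let ?S = "(\<lambda>\<pi>. \<Sum>(i, j)\<leftarrow>\<pi>. w i j) ` directed_paths (1, 1) (k, l)"
  have le: "y \<le> lpp (\<lambda>(i, j). w i j) k l" if y: "y \<in> ?S" for y
  proof -
    obtain \<pi> where "\<pi> \<in> directed_paths (1, 1) (k, l)" "y = (\<Sum>(i, j)\<leftarrow>\<pi>. w i j)" using y by auto
    then show ?thesis
      using path_sum_le_lpp[of \<pi> "\<lambda>(i, j). w i j"] by (auto simp: directed_paths_def)
  qed
  \<comment> \<open>The path sums are bounded natural numbers; this gives the finiteness that
    \<open>Max\<close> requires.\<close>
  have "finite ?S" by (rule finite_subset[of _ "{..lpp (\<lambda>(i, j). w i j) k l}"]) (use le in blast)+
  moreover have "lpp (\<lambda>(i, j). w i j) k l \<in> ?S"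
    using lpp_attained[OF assms, of "\<lambda>(i, j). w i j"] by (metis image_eqI)
  ultimately show ?thesis
    unfolding last_passage_time_def using le by (intro Max_eqI) auto
qed

text \<open>By symmetry about the antidiagonal, the passage time from \<open>(i, j)\<close> to \<open>(N, N)\<close> is
  \<open>lpp w (N + 1 - j) (N + 1 - i)\<close>; the lemma says that a path meets the level \<open>i + j = s\<close>.\<close>

lemma lpp_le_iff_level:
  fixes w :: "nat \<times> nat \<Rightarrow> nat"
  assumes sym: "\<And>i j. i \<in> {1..N} \<Longrightarrow> j \<in> {1..N} \<Longrightarrow> w (i, j) = w (N + 1 - j, N + 1 - i)"
    and s: "2 \<le> s" "s \<le> 2 * N"
  shows "lpp w N N \<le> m \<longleftrightarrow> (\<forall>i\<in>{1..N}. \<forall>j\<in>{1..N}. i + j = s \<longrightarrow>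
     lpp w i j + max (lpp w (N + 1 - j) (N - i)) (lpp w (N - j) (N + 1 - i)) \<le> m)"
  using s(2,1)
proof (induction rule: inc_induct)
  case base
  show ?case
  proof (intro iffI ballI impI)
    fix i j assume "lpp w N N \<le> m" "i \<in> {1..N}" "j \<in> {1..N}" "i + j = 2 * N"
    moreover from this have "i = N" "j = N" by auto
    ultimately show "lpp w i j + max (lpp w (N + 1 - j) (N - i)) (lpp w (N - j) (N + 1 - i)) \<le> m"
      by simp
  next
    assume *: "\<forall>i\<in>{1..N}. \<forall>j\<in>{1..N}. i + j = 2 * N \<longrightarrow>
      lpp w i j + max (lpp w (N + 1 - j) (N - i)) (lpp w (N - j) (N + 1 - i)) \<le> m"
    have "N \<in> {1..N}" using s by simp
    from bspec[OF bspec[OF * this] this] show "lpp w N N \<le> m" by simp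
  qed
next
  case (step s)
  define h where "h i j = lpp w (N + 1 - j) (N + 1 - i)" for i j
  have h_rec: "h i j = max (h (i + 1) j) (h i (j + 1)) + w (i, j)"
    if "i \<in> {1..N}" "j \<in> {1..N}" for i j
  proof -
    have "N + 1 - j = Suc (N - j)" "N + 1 - i = Suc (N - i)" using that by auto
    then show ?thesis using sym[OF that] by (simp add: h_def max.commute)
  qed
  have g_rec: "lpp w i j = max (lpp w (i - 1) j) (lpp w i (j - 1)) + w (i, j)"
    if "i \<in> {1..N}" "j \<in> {1..N}" for i j
    using that by (cases i; cases j) auto
  let ?C = "\<lambda>s. \<forall>i\<in>{1..N}. \<forall>j\<in>{1..N}. i + j = s \<longrightarrow> lpp w i j + max (h (i + 1) j) (h i (j + 1)) \<le> m"
  \<comment> \<open>By the two recursions, both conditions say that \<open>lpp\<close> at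
    \<open>x\<close> plus \<open>h\<close> at \<open>y\<close> is at most \<open>m\<close> for every
    step from a box \<open>x\<close> of level \<open>s\<close> to a box \<open>y\<close> of level
    \<open>Suc s\<close>. At level \<open>s\<close> the maximum runs over \<open>y\<close>, at level
    \<open>Suc s\<close> over \<open>x\<close>. Neighbours outside the square contribute 0.\<close>
  have "?C (Suc s) \<longleftrightarrow> ?C s"
  proof
    assume C: "?C (Suc s)"
    have C': "max (lpp w (i - 1) j) (lpp w i (j - 1)) + h i j \<le> m"
      if "i \<in> {1..N}" "j \<in> {1..N}" "i + j = Suc s" for i j
      using C that g_rec[of i j] h_rec[of i j] by force
    show "?C s"
    proof (intro ballI impI)
      fix i j assume *: "i \<in> {1..N}" "j \<in> {1..N}" "i + j = s"
      have "lpp w i j + h (i + 1) j \<le> m" if "i < N"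
        using C'[of "i + 1" j] * that by auto
      moreover have "lpp w i j + h i (j + 1) \<le> m" if "j < N"
        using C'[of i "j + 1"] * that by auto
      moreover have "i < N \<or> j < N" using * step.hyps by auto
      moreover have "h (i + 1) j = 0" if "\<not> i < N" using that * by (simp add: h_def)
      moreover have "h i (j + 1) = 0" if "\<not> j < N" using that * by (simp add: h_def)
      ultimately show "lpp w i j + max (h (i + 1) j) (h i (j + 1)) \<le> m"
        by (cases "i < N"; cases "j < N") auto
    qed
  next
    assume C: "?C s"
    have C1: "lpp w i j + h (i + 1) j \<le> m" "lpp w i j + h i (j + 1) \<le> m"
      if "i \<in> {1..N}" "j \<in> {1..N}" "i + j = s" for i j
      using C that by force+
    show "?C (Suc s)"
    proof (intro ballI impI)
      fix i j assume *: "i \<in> {1..N}" "j \<in> {1..N}" "i + j = Suc s"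
      have 1: "lpp w (i - 1) j + h i j \<le> m" if "1 < i"
      proof -
        have "i - 1 \<in> {1..N}" "i - 1 + j = s" using * that by auto
        from C1(1)[OF this(1) *(2) this(2)] show ?thesis using that by simp
      qed
      have 2: "lpp w i (j - 1) + h i j \<le> m" if "1 < j"
      proof -
        have "j - 1 \<in> {1..N}" "i + (j - 1) = s" using * that by auto
        from C1(2)[OF *(1) this] show ?thesis using that by simp
      qed
      have 3: "1 < i \<or> 1 < j" using * step.prems by auto
      have 4: "lpp w (i - 1) j = 0" if "\<not> 1 < i" using that * by auto
      have 5: "lpp w i (j - 1) = 0" if "\<not> 1 < j" using that * by auto
      have "max (lpp w (i - 1) j) (lpp w i (j - 1)) + h i j \<le> m"
        using 1 2 3 4 5 by (cases "1 < i"; cases "1 < j") auto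
      then show "lpp w i j + max (h (i + 1) j) (h i (j + 1)) \<le> m"
        using g_rec[OF *(1,2)] h_rec[OF *(1,2)] by linarith
    qed
  qed
  moreover have "lpp w N N \<le> m \<longleftrightarrow> ?C (Suc s)"
    using step.IH step.prems by (simp add: h_def)
  ultimately show ?case by (simp add: h_def)
qed

definition weight_array :: "nat \<Rightarrow> (nat \<Rightarrow> nat \<Rightarrow> nat) \<Rightarrow> nat \<times> nat \<Rightarrow> int" where
  "weight_array n w = (\<lambda>(i, j). if (i, j) \<in> triangle (2 * n) then 2 * int (w i j)
     else if (i, j) \<in> triangle (2 * n + 1) then int (w i j) else 0)"

text \<open>At \<open>s = 2*n + 1\<close> each box is its own mirror image, so the level condition
  bounds twice the best time to a predecessor plus the weight of the box. This is the passage time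
  for \<open>weight_array\<close>, which doubles all weights before the antidiagonal. Symmetry about
  the main diagonal leaves \<open>i \<le> n\<close>.\<close>

lemma last_passage_time_le_iff:
  assumes "1 \<le> n"
    and sym: "\<And>i j. i \<in> {1..2*n} \<Longrightarrow> j \<in> {1..2*n} \<Longrightarrow> w i j = w (2*n + 1 - j) (2*n + 1 - i) \<and> w i j = w j i"
  shows "last_passage_time w (2*n) (2*n) \<le> m \<longleftrightarrow>
     (\<forall>i\<in>{1..n}. lpp (symmetrize (weight_array n w)) i (2*n + 1 - i) \<le> int m)"
proof -
  let ?w = "\<lambda>(i, j). w i j" and ?V = "symmetrize (weight_array n w)"
  have V: "?V (i, j) = (if i + j \<le> 2 * n then 2 else 1) * int (w i j)"
    if "1 \<le> i" "1 \<le> j" "i + j \<le> 2 * n + 1" for i j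
  proof (cases "i \<le> j")
    case True
    then show ?thesis using that by (auto simp: symmetrize_def weight_array_def triangle_def)
  next
    case False
    have "w i j = w j i" using that sym[of i j] by auto
    then show ?thesis using that False by (auto simp: symmetrize_def weight_array_def triangle_def)
  qed
  have double: "i + j \<le> 2 * n \<Longrightarrow> lpp ?V i j = 2 * int (lpp ?w i j)" for i j
  proof (induction ?w i j rule: lpp.induct)
    case (3 i j)
    then show ?case using V[of "Suc i" "Suc j"] by (simp add: max_def)
  qed auto
  have anti: "lpp ?V i (2 * n + 1 - i) =
      int (lpp ?w i (2 * n + 1 - i) + max (lpp ?w i (2 * n - i)) (lpp ?w (i - 1) (2 * n + 1 - i)))"
    if "i \<in> {1..n}" for i
  proof -
    define a where "a = i - 1"
    have a: "i = Suc a" using that by (auto simp: a_def)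
    define b where "b = 2 * n - i"
    have b: "2 * n + 1 - i = Suc b" "2 * n - i = b" using that by (auto simp: b_def)
    have "a + Suc b = 2 * n" using a b that by auto
    then show ?thesis
      unfolding b unfolding a
      using double[of a "Suc b"] double[of "Suc a" b] V[of "Suc a" "Suc b"] by simp
  qed
  let ?D = "\<lambda>i. lpp ?w i (2 * n + 1 - i) + max (lpp ?w i (2 * n - i)) (lpp ?w (i - 1) (2 * n + 1 - i)) \<le> m"
  have "lpp ?w (2 * n) (2 * n) \<le> m \<longleftrightarrow> (\<forall>i\<in>{1..2*n}. \<forall>j\<in>{1..2*n}. i + j = 2 * n + 1 \<longrightarrow>
     lpp ?w i j + max (lpp ?w (2 * n + 1 - j) (2 * n - i)) (lpp ?w (2 * n - j) (2 * n + 1 - i)) \<le> m)"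
    by (rule lpp_le_iff_level) (use sym \<open>1 \<le> n\<close> in auto)
  also have "\<dots> \<longleftrightarrow> (\<forall>i\<in>{1..2*n}. ?D i)"
  proof -
    have "2 * n + 1 - (2 * n + 1 - i) = i" "2 * n - (2 * n + 1 - i) = i - 1" "2 * n + 1 - i \<in> {1..2*n}"
      if "i \<in> {1..2*n}" for i
      using that by auto
    moreover have "j = 2 * n + 1 - i" if "i + j = 2 * n + 1" for i j using that by auto
    ultimately show ?thesis by (smt (verit) atLeastAtMost_iff le_add_diff_inverse le_SucI Suc_eq_plus1)
  qed
  also have "\<dots> \<longleftrightarrow> (\<forall>i\<in>{1..n}. ?D i)"
  proof -
    have transpose: "lpp ?w i j = lpp ?w j i" if "i \<le> 2 * n" "j \<le> 2 * n" for i j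
    proof (rule lpp_transpose)
      fix a b assume "a \<in> {1..i}" "b \<in> {1..j}"
      then have "w a b = w b a" using sym[of a b] that by auto
      then show "?w (a, b) = ?w (b, a)" by simp
    qed
    have "?D (2 * n + 1 - i) \<longleftrightarrow> ?D i" if "i \<in> {1..2*n}" for i
    proof -
      have eq: "2 * n + 1 - (2 * n + 1 - i) = i" "2 * n - (2 * n + 1 - i) = i - 1" "2 * n + 1 - i - 1 = 2 * n - i"
        using that by auto
      show ?thesis
        unfolding eq
        using that transpose[of "2 * n + 1 - i" i] transpose[of "2 * n + 1 - i" "i - 1"] transpose[of "2 * n - i" i]
        by (auto simp: max.commute)
    qed
    moreover have "i \<in> {1..n} \<or> 2 * n + 1 - i \<in> {1..n}" if "i \<in> {1..2*n}" for i
      using that by auto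
    moreover have "{1..n} \<subseteq> {1..2*n}" by auto
    ultimately show ?thesis by blast
  qed
  also have "\<dots> \<longleftrightarrow> (\<forall>i\<in>{1..n}. lpp ?V i (2 * n + 1 - i) \<le> int m)"
    by (intro ball_cong refl) (simp only: anti of_nat_le_iff)
  finally show ?thesis using last_passage_time_eq_lpp[of "2 * n" "2 * n" w] \<open>1 \<le> n\<close> by simp
qed

subsection \<open>The law of the last passage time\<close>

definition bounded_inputs :: "nat \<Rightarrow> nat \<Rightarrow> (nat \<times> nat \<Rightarrow> int) set" where
  "bounded_inputs n m = {v \<in> arrays (2*n + 1) {}.
     \<forall>i\<in>{1..n}. lpp (symmetrize v) i (2*n + 1 - i) \<le> int m}"

definition bounded_outputs :: "nat \<Rightarrow> nat \<Rightarrow> (nat \<times> nat \<Rightarrow> int) set" where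
  "bounded_outputs n m = {t \<in> arrays (2*n + 1) (triangle (2*n + 1)). \<forall>x. t x \<le> int m}"

lemma finite_triangle: "finite (triangle N)"
  by (rule finite_subset[of _ "{..N} \<times> {..N}"]) (auto simp: triangle_def)

lemma order_ideal_triangle: "order_ideal (triangle N)"
  by (auto simp: order_ideal_def triangle_def)

lemma array_row_mono:
  assumes f: "f \<in> arrays N (triangle N)" and "1 \<le> i" "i \<le> j" "i + j' \<le> N" "j \<le> j'"
  shows "f (i, j) \<le> f (i, j')"
  using assms(5,4)
proof (induction j' rule: dec_induct)
  case (step j')
  have "lo f i (Suc j') \<le> f (i, Suc j')"
    using f step assms by (auto simp: arrays_def triangle_def)
  then show ?case using step assms by (auto simp: lo_def split: if_splits)
qed auto

text \<open>The rows increase and end on the antidiagonal, so a bound there bounds every entry and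
  leaves finitely many arrays.\<close>

lemma bounded_outputs_iff:
  "t \<in> bounded_outputs n m \<longleftrightarrow>
     t \<in> arrays (2*n + 1) (triangle (2*n + 1)) \<and> (\<forall>i\<in>{1..n}. t (i, 2*n + 1 - i) \<le> int m)"
proof safe
  assume t: "t \<in> arrays (2*n + 1) (triangle (2*n + 1))" "\<forall>i\<in>{1..n}. t (i, 2*n + 1 - i) \<le> int m"
  have "t (i, j) \<le> int m" for i j
  proof (cases "(i, j) \<in> triangle (2*n + 1)")
    case True
    then have "t (i, j) \<le> t (i, 2*n + 1 - i)"
      by (intro array_row_mono[OF t(1)]) (auto simp: triangle_def)
    moreover have "i \<in> {1..n}" using True by (auto simp: triangle_def)
    ultimately show ?thesis using t(2) by force
  qed (use t in \<open>auto simp: arrays_def\<close>)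
  then show "t \<in> bounded_outputs n m" using t by (auto simp: bounded_outputs_def)
qed (auto simp: bounded_outputs_def)

lemma finite_bounded_outputs: "finite (bounded_outputs n m)"
proof (rule finite_subset[OF _ finite_set_of_finite_funs[OF finite_triangle, of "{0..int m}" "2*n + 1" 0]])
  show "bounded_outputs n m \<subseteq> {f. \<forall>x. (x \<in> triangle (2*n + 1) \<longrightarrow> f x \<in> {0..int m}) \<and>
      (x \<notin> triangle (2*n + 1) \<longrightarrow> f x = 0)}"
    by (auto simp: bounded_outputs_def arrays_def simp del: split_paired_All)
qed auto

text \<open>The boxes named here are the border of the full triangle: those on the antidiagonal will
  give the odd rows of a pattern, those one level before it the even rows. The bound carries over
  because the output on the antidiagonal is the passage time of the input.\<close>

lemma bounded_bijection:
  "\<exists>\<Phi>. bij_betw \<Phi> (bounded_inputs n m) (bounded_outputs n m) \<and>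
     (\<forall>v\<in>arrays (2*n + 1) {}. \<forall>i\<in>{1..n}.
        border_inv v (\<Phi> v) i (2*n + 1 - i) \<and> border_inv v (\<Phi> v) i (2*n - i))"
proof -
  let ?T = "triangle (2*n + 1)"
  obtain \<Phi> where \<Phi>: "bij_betw \<Phi> (arrays (2*n + 1) {}) (arrays (2*n + 1) ?T)"
    "\<And>w i j. w \<in> arrays (2*n + 1) {} \<Longrightarrow> (i, j) \<in> ?T \<Longrightarrow> (Suc i, Suc j) \<notin> ?T \<Longrightarrow> border_inv w (\<Phi> w) i j"
    using RSK_bijection[OF finite_triangle order_ideal_triangle subset_refl] by blast
  have inv: "border_inv v (\<Phi> v) i (2*n + 1 - i)" "border_inv v (\<Phi> v) i (2*n - i)"
    if "v \<in> arrays (2*n + 1) {}" "i \<in> {1..n}" for v i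
    using that by (auto intro!: \<Phi>(2) simp: triangle_def)
  have iff: "v \<in> bounded_inputs n m \<longleftrightarrow> \<Phi> v \<in> bounded_outputs n m" if v: "v \<in> arrays (2*n + 1) {}" for v
    unfolding bounded_outputs_iff bounded_inputs_def
    using inv[OF v] v bij_betwE[OF \<Phi>(1)] by (auto simp: border_inv_def)
  have inputs: "bounded_inputs n m \<subseteq> arrays (2*n + 1) {}" by (auto simp: bounded_inputs_def)
  have "\<Phi> ` bounded_inputs n m = bounded_outputs n m"
  proof (intro equalityI subsetI)
    fix t assume "t \<in> \<Phi> ` bounded_inputs n m"
    then show "t \<in> bounded_outputs n m" using iff inputs by auto
  next
    fix t assume t: "t \<in> bounded_outputs n m"
    then have "t \<in> \<Phi> ` arrays (2*n + 1) {}"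
      unfolding bij_betw_imp_surj_on[OF \<Phi>(1)] by (simp add: bounded_outputs_def)
    then show "t \<in> \<Phi> ` bounded_inputs n m" using iff t by auto
  qed
  with bij_betw_subset[OF \<Phi>(1) inputs] have "bij_betw \<Phi> (bounded_inputs n m) (bounded_outputs n m)"
    by simp
  then show ?thesis using inv by blast
qed

lemma finite_bounded_inputs: "finite (bounded_inputs n m)"
  using bounded_bijection[of n m] finite_bounded_outputs bij_betw_finite by metis

section \<open>Independence and the probability of a prescribed weight array\<close>

definition scale :: "nat \<Rightarrow> nat \<times> nat \<Rightarrow> nat" where
  "scale n x = (if x \<in> triangle (2*n) then 2 else 1)"

lemma triangle_mono: "triangle (2 * n) \<subseteq> triangle (2 * n + 1)"
  by (auto simp: triangle_def)

lemma weight_array_in_arrays: "weight_array n w \<in> arrays (2*n + 1) {}"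
  using triangle_mono[of n] by (auto simp: weight_array_def arrays_def)

text \<open>Splits the event of a prescribed array into one equation per box, the form to which
  independence applies. The division is exact, as \<open>v\<close> is even wherever
  \<open>scale\<close> is 2.\<close>

lemma weight_array_eq_iff:
  assumes v: "v \<in> arrays (2*n + 1) {}"
  shows "weight_array n w = v \<longleftrightarrow>
    (\<forall>x\<in>triangle (2*n + 1). w (fst x) (snd x) = nat (v x) div scale n x)"
proof
  show "\<forall>x\<in>triangle (2*n + 1). w (fst x) (snd x) = nat (v x) div scale n x" if "weight_array n w = v"
    unfolding that[symmetric] by (auto simp: weight_array_def scale_def nat_mult_distrib)
next
  assume w: "\<forall>x\<in>triangle (2*n + 1). w (fst x) (snd x) = nat (v x) div scale n x"
  show "weight_array n w = v"
  proof
    fix x :: "nat \<times> nat"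
    obtain i j where x: "x = (i, j)" by force
    have "0 \<le> v x" using v by (auto simp: arrays_def x)
    consider "x \<in> triangle (2*n)" "x \<in> triangle (2*n + 1)"
      | "x \<notin> triangle (2*n)" "x \<in> triangle (2*n + 1)" | "x \<notin> triangle (2*n)" "x \<notin> triangle (2*n + 1)"
      using triangle_mono[of n] by blast
    then show "weight_array n w x = v x"
    proof cases
      case 1
      then have "even (v x)" using v by (auto simp: arrays_def)
      then show ?thesis using 1 w \<open>0 \<le> v x\<close> by (force simp: weight_array_def scale_def x)
    next
      case 2
      then show ?thesis using w \<open>0 \<le> v x\<close> by (force simp: weight_array_def scale_def x)
    next
      case 3
      then show ?thesis using v by (auto simp: weight_array_def arrays_def x)
    qed
  qed
qed

context doubly_symmetric_weights
begin

lemma index_set_eq_triangle: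
  "{(i, j). i \<in> {1..2*n} \<and> j \<in> {1..2*n} \<and> i \<le> j \<and> j \<le> 2*n + 1 - i} = triangle (2*n + 1)"
  by (auto simp: triangle_def)

lemma prob_last_passage_time_le:
  assumes "1 \<le> n"
  shows "prob {\<omega> \<in> space M. last_passage_time (\<lambda>i j. W i j \<omega>) (2*n) (2*n) \<le> m} =
    (\<Sum>v\<in>bounded_inputs n m. \<Prod>(i, j)\<in>triangle (2*n + 1).
       prob {\<omega> \<in> space M. W i j \<omega> = nat (v (i, j)) div scale n (i, j)})"
proof -
  let ?T = "triangle (2*n + 1)"
  let ?k = "\<lambda>v x. nat (v x) div scale n x"
  let ?A = "\<lambda>v. {\<omega> \<in> space M. weight_array n (\<lambda>i j. W i j \<omega>) = v}"
  have indep': "indep_vars (\<lambda>_. count_space UNIV) (\<lambda>(i, j). W i j) ?T"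
    using indep unfolding index_set_eq_triangle .
  then have meas: "(case x of (i, j) \<Rightarrow> W i j) \<in> measurable M (count_space UNIV)" if "x \<in> ?T" for x
    using that by (auto simp: indep_vars_def)
  have "(1, 1) \<in> ?T" using assms by (auto simp: triangle_def)
  then have ne: "?T \<noteq> {}" by blast
  have A_eq: "?A v = (\<Inter>x\<in>?T. (case x of (i, j) \<Rightarrow> W i j) -` {?k v x} \<inter> space M)"
    if "v \<in> bounded_inputs n m" for v
  proof -
    have "v \<in> arrays (2*n + 1) {}" using that by (simp add: bounded_inputs_def)
    from weight_array_eq_iff[OF this, of "\<lambda>i j. W i j _"] show ?thesis
      unfolding split_beta using ne by auto
  qed
  have A_sets: "?A v \<in> sets M" if "v \<in> bounded_inputs n m" for v
    unfolding A_eq[OF that]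
    using ne finite_triangle meas by (intro sets.finite_INT) (auto intro: measurable_sets)
  have A_prob: "prob (?A v) = (\<Prod>(i, j)\<in>?T. prob {\<omega> \<in> space M. W i j \<omega> = ?k v (i, j)})"
    if "v \<in> bounded_inputs n m" for v
  proof -
    have "prob (?A v) = (\<Prod>x\<in>?T. prob ((case x of (i, j) \<Rightarrow> W i j) -` {?k v x} \<inter> space M))"
      unfolding A_eq[OF that]
      by (rule indep_varsD[OF indep' ne finite_triangle subset_refl]) auto
    also have "\<dots> = (\<Prod>(i, j)\<in>?T. prob {\<omega> \<in> space M. W i j \<omega> = ?k v (i, j)})"
    proof (intro prod.cong refl)
      fix x
      have "(case x of (i, j) \<Rightarrow> W i j) -` {?k v x} \<inter> space M =
          (case x of (i, j) \<Rightarrow> {\<omega> \<in> space M. W i j \<omega> = ?k v (i, j)})"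
        by (cases x) auto
      then show "prob ((case x of (i, j) \<Rightarrow> W i j) -` {?k v x} \<inter> space M) =
          (case x of (i, j) \<Rightarrow> prob {\<omega> \<in> space M. W i j \<omega> = ?k v (i, j)})"
        by (cases x) simp
    qed
    finally show ?thesis .
  qed
  have "{\<omega> \<in> space M. last_passage_time (\<lambda>i j. W i j \<omega>) (2*n) (2*n) \<le> m} = (\<Union>v\<in>bounded_inputs n m. ?A v)"
  proof -
    have "last_passage_time (\<lambda>i j. W i j \<omega>) (2*n) (2*n) \<le> m \<longleftrightarrow>
        weight_array n (\<lambda>i j. W i j \<omega>) \<in> bounded_inputs n m" if "\<omega> \<in> space M" for \<omega>
    proof -
      have "last_passage_time (\<lambda>i j. W i j \<omega>) (2*n) (2*n) \<le> m \<longleftrightarrow>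
        (\<forall>i\<in>{1..n}. lpp (symmetrize (weight_array n (\<lambda>i j. W i j \<omega>))) i (2*n + 1 - i) \<le> int m)"
        by (rule last_passage_time_le_iff[OF assms]) (rule symmetric[OF _ _ that])
      then show ?thesis unfolding bounded_inputs_def using weight_array_in_arrays by blast
    qed
    then show ?thesis by blast
  qed
  then have "prob {\<omega> \<in> space M. last_passage_time (\<lambda>i j. W i j \<omega>) (2*n) (2*n) \<le> m} =
      prob (\<Union>v\<in>bounded_inputs n m. ?A v)" by simp
  also have "\<dots> = (\<Sum>v\<in>bounded_inputs n m. prob (?A v))"
    using A_sets by (intro finite_measure_finite_Union finite_bounded_inputs)
      (auto simp: disjoint_family_on_def)
  finally show ?thesis using A_prob by simp
qed

end

subsection \<open>Weights of the inputs\<close>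

lemma reflect_reflect: "i \<in> {1..n} \<Longrightarrow> reflect n p (2*n + 1 - i) = reflect n p i"
  by (auto simp: reflect_def)

lemma reflect_pos:
  assumes "\<And>j. j \<in> {1..n} \<Longrightarrow> 0 < p j" "j \<in> {1..2*n}"
  shows "0 < reflect n p j"
proof (cases "j \<le> n")
  case False
  then have "2*n + 1 - j \<in> {1..n}" using assms(2) by auto
  then show ?thesis using assms(1) False by (simp add: reflect_def)
qed (use assms in \<open>auto simp: reflect_def\<close>)

text \<open>Differences of rectangle weights isolate row \<open>i\<close> and column \<open>2n + 1 - i\<close>, the two lines
  carrying the variable \<open>p i\<close>.\<close>

definition exponent :: "(nat \<times> nat \<Rightarrow> int) \<Rightarrow> nat \<Rightarrow> nat \<Rightarrow> int" where
  "exponent v n i = 2 * rect v i (2*n + 1 - i) - rect v (i - 1) (2*n + 1 - i) - rect v i (2*n - i)"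

lemma exponent_eq:
  assumes "a \<in> {1..n}"
  shows "exponent v n a = (\<Sum>b = 1..2*n + 1 - a. symmetrize v (a, b)) + (\<Sum>b = 1..a. symmetrize v (2*n + 1 - a, b))"
proof -
  obtain c where c: "a = Suc c" using assms by (cases a) auto
  define d where "d = 2*n - a"
  have d: "2*n + 1 - a = Suc d" "2*n - a = d" using assms by (auto simp: d_def)
  have "(\<Sum>b = 1..a. symmetrize v (Suc d, b)) = (\<Sum>b = 1..a. symmetrize v (b, Suc d))"
    by (simp add: symmetrize_sym)
  then show ?thesis unfolding exponent_def d by (simp add: c rect_def sum.distrib)
qed

text \<open>Unfold the triangle symmetrically: off the main diagonal, box \<open>(i, j)\<close>
  gives \<open>l i\<close> in row \<open>i\<close> and \<open>l j\<close> in row \<open>j\<close>,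
  so the sum becomes one of row sums. Rows \<open>i\<close> and \<open>2*n + 1 - i\<close> carry the
  same value \<open>l i\<close> and together make up \<open>exponent v n i\<close>.\<close>

lemma sum_exponent:
  fixes l :: "nat \<Rightarrow> real"
  assumes l: "\<And>i. i \<in> {1..n} \<Longrightarrow> l (2*n + 1 - i) = l i"
  shows "(\<Sum>(i, j)\<in>triangle (2*n + 1). of_int (v (i, j)) * (l i + (if i < j then l j else 0))) =
     (\<Sum>i = 1..n. l i * of_int (exponent v n i))"
proof -
  let ?s = "\<lambda>a b. real_of_int (symmetrize v (a, b))"
  let ?T = "triangle (2*n + 1)" and ?U = "{(i, j) \<in> triangle (2*n + 1). i < j}"
  let ?r = "\<lambda>a. l a * (\<Sum>b = 1..2*n + 1 - a. ?s a b)"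
  have fin: "finite ?T" "finite ?U" "finite (prod.swap ` ?U)"
    using finite_triangle by (auto intro: finite_subset)
  have "(\<Sum>i = 1..n. l i * of_int (exponent v n i)) =
     (\<Sum>i = 1..n. ?r i) + (\<Sum>i = 1..n. ?r (2*n + 1 - i))"
    unfolding sum.distrib[symmetric]
    by (intro sum.cong refl) (simp only: exponent_eq of_int_add of_int_sum l, auto simp: algebra_simps)
  also have "(\<Sum>i = 1..n. ?r (2*n + 1 - i)) = (\<Sum>i = n+1..2*n. ?r i)"
    by (rule sum.reindex_bij_witness[of _ "\<lambda>i. 2*n + 1 - i" "\<lambda>i. 2*n + 1 - i"]) auto
  also have "(\<Sum>i = 1..n. ?r i) + \<dots> = (\<Sum>i = 1..2*n. ?r i)"
    using sum.ub_add_nat[of 1 n ?r n] by (simp add: mult_2)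
  also have "\<dots> = (\<Sum>(a, b)\<in>(SIGMA a:{1..2*n}. {1..2*n + 1 - a}). l a * ?s a b)"
    by (simp add: sum_distrib_left sum.Sigma)
  also have "(SIGMA a:{1..2*n}. {1..2*n + 1 - a}) = ?T \<union> prod.swap ` ?U"
    by (auto simp: triangle_def image_iff)
  also have "(\<Sum>(a, b)\<in>\<dots>. l a * ?s a b) =
      (\<Sum>(a, b)\<in>?T. l a * ?s a b) + (\<Sum>(a, b)\<in>prod.swap ` ?U. l a * ?s a b)"
    by (rule sum.union_disjoint) (use fin in \<open>auto simp: triangle_def\<close>)
  also have "(\<Sum>(a, b)\<in>prod.swap ` ?U. l a * ?s a b) = (\<Sum>(a, b)\<in>?U. l b * ?s a b)"
    by (subst sum.reindex) (auto simp: split_beta symmetrize_def min.commute max.commute)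
  also have "\<dots> = (\<Sum>(a, b)\<in>?T. if a < b then l b * ?s a b else 0)"
    using fin by (auto simp: split_beta sum.inter_filter[symmetric] intro!: sum.mono_neutral_cong_left)
  also have "(\<Sum>(a, b)\<in>?T. l a * ?s a b) + \<dots> =
      (\<Sum>(i, j)\<in>?T. of_int (v (i, j)) * (l i + (if i < j then l j else 0)))"
    unfolding sum.distrib[symmetric]
    by (intro sum.cong refl) (auto simp: triangle_def symmetrize_def algebra_simps)
  finally show ?thesis by simp
qed

text \<open>The reflection of column \<open>j\<close> to \<open>2*n + 1 - j\<close> folds the
  generic boxes right of column \<open>n\<close> onto the pairs \<open>i < j \<le> n\<close>. Each
  pair is thus covered twice, with the same two variables.\<close>

lemma triangle_partition:
  fixes n :: nat
  defines "D \<equiv> (\<lambda>j. (j, j)) ` {1..n}" and "A \<equiv> (\<lambda>i. (i, 2*n + 1 - i)) ` {1..n}"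
    and "G \<equiv> {(i, j). 1 \<le> i \<and> i < j \<and> j \<le> n}"
  shows "triangle (2*n + 1) = D \<union> A \<union> (G \<union> (\<lambda>(i, j). (i, 2*n + 1 - j)) ` G)"
    (is "?T = D \<union> A \<union> (G \<union> ?G')")
proof (intro equalityI subrelI)
  fix i j assume ij: "(i, j) \<in> ?T"
  consider "i = j" | "i + j = 2*n + 1" | "i < j" "j \<le> n" | "n < j" "i + j < 2*n + 1"
    using ij by (force simp: triangle_def)
  then show "(i, j) \<in> D \<union> A \<union> (G \<union> ?G')"
  proof cases
    case 4
    then have "(i, 2*n + 1 - j) \<in> G" "2*n + 1 - (2*n + 1 - j) = j"
      using ij by (auto simp: G_def triangle_def)
    then show ?thesis by force
  qed (use ij in \<open>auto simp: D_def A_def G_def triangle_def\<close>)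
qed (auto simp: D_def A_def G_def triangle_def)

lemma prod_triangle:
  fixes f :: "nat \<Rightarrow> nat \<Rightarrow> real"
  shows "(\<Prod>(i, j)\<in>triangle (2*n + 1). f i j) =
    (\<Prod>j = 1..n. f j j) * (\<Prod>i = 1..n. f i (2*n + 1 - i)) *
    (\<Prod>(i, j)\<in>{(i, j). 1 \<le> i \<and> i < j \<and> j \<le> n}. f i j * f i (2*n + 1 - j))"
proof -
  let ?G = "{(i, j). 1 \<le> i \<and> i < j \<and> j \<le> n}"
  let ?D = "(\<lambda>j. (j, j)) ` {1..n}" and ?A = "(\<lambda>i. (i, 2*n + 1 - i)) ` {1..n}"
  let ?G' = "(\<lambda>(i, j). (i, 2*n + 1 - j)) ` ?G"
  have finG: "finite ?G" by (rule finite_subset[of _ "{..n} \<times> {..n}"]) auto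
  have "(\<Prod>(i, j)\<in>triangle (2*n + 1). f i j) =
     (\<Prod>(i, j)\<in>?D. f i j) * (\<Prod>(i, j)\<in>?A. f i j) * ((\<Prod>(i, j)\<in>?G. f i j) * (\<Prod>(i, j)\<in>?G'. f i j))"
  proof -
    have "finite ?D" "finite ?A" "finite ?G'" using finG by auto
    moreover have "?D \<inter> ?A = {}" "(?D \<union> ?A) \<inter> (?G \<union> ?G') = {}" "?G \<inter> ?G' = {}" by auto
    ultimately show ?thesis
      unfolding triangle_partition using finG by (simp only: prod.union_disjoint finite_Un)
  qed
  also have "(\<Prod>(i, j)\<in>?D. f i j) = (\<Prod>j = 1..n. f j j)"
    by (subst prod.reindex) (auto intro: inj_onI)
  also have "(\<Prod>(i, j)\<in>?A. f i j) = (\<Prod>i = 1..n. f i (2*n + 1 - i))"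
    by (subst prod.reindex) (auto intro: inj_onI)
  also have "(\<Prod>(i, j)\<in>?G'. f i j) = (\<Prod>(i, j)\<in>?G. f i (2*n + 1 - j))"
    by (subst prod.reindex) (auto intro!: inj_onI prod.cong simp: split_beta)
  finally have "(\<Prod>(i, j)\<in>triangle (2*n + 1). f i j) = (\<Prod>j = 1..n. f j j) * (\<Prod>i = 1..n. f i (2*n + 1 - i)) *
     ((\<Prod>(i, j)\<in>?G. f i j) * (\<Prod>(i, j)\<in>?G. f i (2*n + 1 - j)))" .
  moreover have "(\<Prod>(i, j)\<in>?G. f i j) * (\<Prod>(i, j)\<in>?G. f i (2*n + 1 - j)) =
      (\<Prod>(i, j)\<in>?G. f i j * f i (2*n + 1 - j))"
    unfolding prod.distrib[symmetric] by (intro prod.cong refl) auto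
  ultimately show ?thesis by (simp only:)
qed

context doubly_symmetric_weights
begin

text \<open>One exponential fits all three laws. Halving undoes the doubling before the
  antidiagonal, where a generic box carries two variables and a diagonal box just one; on the
  antidiagonal the weight is not doubled, but its two variables coincide.\<close>

lemma prob_weight:
  assumes p: "\<And>j. j \<in> {1..n} \<Longrightarrow> 0 < p j" and v: "v \<in> arrays (2*n + 1) {}"
    and ij: "(i, j) \<in> triangle (2*n + 1)"
  defines "k \<equiv> nat (v (i, j)) div scale n (i, j)" and "q \<equiv> reflect n p"
  shows "prob {\<omega> \<in> space M. W i j \<omega> = k} =
    (if i = j then 1 - \<alpha> * p j
     else if i + j = 2*n + 1 then (1 - (q j)\<^sup>2) / (1 + \<beta> * q j) else 1 - q i * q j) *
    ((if i = j then \<alpha> ^ k else if i + j = 2*n + 1 then \<beta> ^ (k mod 2) else 1) *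
     exp (of_int (v (i, j)) * (ln (q i) + (if i < j then ln (q j) else 0)) / 2))"
proof -
  have bounds: "1 \<le> i" "i \<le> j" "i + j \<le> 2*n + 1" using ij by (auto simp: triangle_def)
  have "0 \<le> v (i, j)" using v by (auto simp: arrays_def)
  have q: "0 < q i" "0 < q j"
    unfolding q_def by (rule reflect_pos; use p bounds in auto)+
  have pow: "exp (real k * ln x) = x ^ k" if "0 < x" for x
    using that by (simp add: exp_of_nat_mult)
  have vk: "real_of_int (v (i, j)) = real (scale n (i, j) * k)"
  proof -
    have "even (v (i, j))" if "(i, j) \<in> triangle (2*n)"
      using v that by (auto simp: arrays_def)
    then have "v (i, j) = int (scale n (i, j) * k)"
      using \<open>0 \<le> v (i, j)\<close> by (auto simp: k_def scale_def even_nat_iff)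
    then show ?thesis by linarith
  qed
  consider "i = j" | "i < j" "i + j = 2*n + 1" | "i < j" "i + j < 2*n + 1" using bounds by linarith
  then show ?thesis
  proof cases
    case 1
    then have "i + j \<le> 2*n" using bounds by presburger
    then have "scale n (i, j) = 2" using bounds by (auto simp: scale_def triangle_def)
    then have "exp (of_int (v (i, j)) * (ln (q i) + (if i < j then ln (q j) else 0)) / 2) = q i ^ k"
      using pow[OF q(1)] vk 1 by simp
    moreover have "q i = p j" using 1 bounds by (auto simp: q_def reflect_def)
    ultimately show ?thesis using law_diagonal[of j k] 1 bounds by (simp add: power_mult_distrib)
  next
    case 2
    then have s: "scale n (i, j) = 1" by (auto simp: scale_def triangle_def)
    have "j = 2*n + 1 - i" "i \<in> {1..n}" using 2 bounds by auto
    then have "q i = q j" using reflect_reflect[of i n p] by (simp add: q_def)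
    then have "exp (of_int (v (i, j)) * (ln (q i) + (if i < j then ln (q j) else 0)) / 2) = q j ^ k"
      using pow[OF q(2)] 2 s by (simp add: vk)
    then show ?thesis using law_antidiagonal[of i j k] 2 bounds \<open>j = _\<close> by (simp add: q_def)
  next
    case 3
    then have s: "scale n (i, j) = 2" using bounds by (auto simp: scale_def triangle_def)
    then have "exp (of_int (v (i, j)) * (ln (q i) + (if i < j then ln (q j) else 0)) / 2) = q i ^ k * q j ^ k"
      using pow[OF q(2)] pow[OF q(1)] 3 by (simp add: vk distrib_left add_divide_distrib exp_add)
    then show ?thesis using law_generic[of i j k] 3 bounds by (simp add: q_def power_mult_distrib)
  qed
qed

text \<open>The normalising factors \<open>f\<close> cancel against the constant, the factors
  \<open>g\<close> give the powers of \<open>\<alpha>\<close> and \<open>\<beta>\<close>, and the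
  exponentials regroup by \<open>sum_exponent\<close>.\<close>

lemma prod_prob_weight:
  assumes p: "\<And>j. j \<in> {1..n} \<Longrightarrow> 0 < p j \<and> p j < 1" and "0 \<le> \<beta>"
    and \<alpha>: "\<And>j. j \<in> {1..n} \<Longrightarrow> \<alpha> * p j < 1" and v: "v \<in> arrays (2*n + 1) {}"
  shows "(\<Prod>(i, j)\<in>{(i, j). 1 \<le> i \<and> i < j \<and> j \<le> n}. 1 / (1 - p i * p j)\<^sup>2)
         * (\<Prod>j = 1..n. (1 + \<beta> * p j) / (1 - (p j)\<^sup>2) * (1 / (1 - \<alpha> * p j)))
         * (\<Prod>(i, j)\<in>triangle (2*n + 1).
              prob {\<omega> \<in> space M. W i j \<omega> = nat (v (i, j)) div scale n (i, j)}) =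
    \<alpha> ^ (\<Sum>j = 1..n. nat (v (j, j)) div 2) * \<beta> ^ card {i \<in> {1..n}. odd (v (i, 2*n + 1 - i))} *
    (\<Prod>i = 1..n. p i powr (of_int (exponent v n i) / 2))"
proof -
  let ?T = "triangle (2*n + 1)" and ?G = "{(i, j). 1 \<le> i \<and> i < j \<and> j \<le> n}"
  define q where "q = reflect n p"
  define l where "l i = ln (q i)" for i
  define k where "k x = nat (v x) div scale n x" for x
  define f where "f i j = (if i = j then 1 - \<alpha> * p j
     else if i + j = 2*n + 1 then (1 - (q j)\<^sup>2) / (1 + \<beta> * q j) else 1 - q i * q j)" for i j
  define g where "g i j = (if i = j then \<alpha> ^ k (i, j) else if i + j = 2*n + 1 then \<beta> ^ (k (i, j) mod 2) else 1)" for i j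
  have nonneg: "0 \<le> v x" for x using v by (cases x) (auto simp: arrays_def)
  have qp: "q i = p i" "q (2*n + 1 - i) = p i" if "i \<in> {1..n}" for i
    using that by (auto simp: q_def reflect_def)
  have "(\<Prod>(i, j)\<in>?T. prob {\<omega> \<in> space M. W i j \<omega> = k (i, j)}) =
      (\<Prod>(i, j)\<in>?T. f i j * (g i j * exp (of_int (v (i, j)) * (l i + (if i < j then l j else 0)) / 2)))"
  proof (intro prod.cong refl, clarify)
    fix i j assume ij: "(i, j) \<in> ?T"
    show "prob {\<omega> \<in> space M. W i j \<omega> = k (i, j)} =
      f i j * (g i j * exp (of_int (v (i, j)) * (l i + (if i < j then l j else 0)) / 2))"
      using prob_weight[OF _ v ij] p unfolding k_def f_def g_def l_def q_def by blast
  qed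
  also have "\<dots> = (\<Prod>(i, j)\<in>?T. f i j) * ((\<Prod>(i, j)\<in>?T. g i j) *
      exp ((\<Sum>(i, j)\<in>?T. of_int (v (i, j)) * (l i + (if i < j then l j else 0))) / 2))"
    by (simp add: prod.distrib split_beta sum_divide_distrib exp_sum finite_triangle)
  also have "(\<Sum>(i, j)\<in>?T. of_int (v (i, j)) * (l i + (if i < j then l j else 0))) =
      (\<Sum>i = 1..n. l i * of_int (exponent v n i))"
    by (rule sum_exponent) (simp only: l_def qp)
  also have "exp (\<dots> / 2) = (\<Prod>i = 1..n. p i powr (of_int (exponent v n i) / 2))"
    unfolding sum_divide_distrib exp_sum[OF finite_atLeastAtMost]
  proof (intro prod.cong refl)
    fix i assume "i \<in> {1..n}"
    then show "exp (l i * of_int (exponent v n i) / 2) = p i powr (of_int (exponent v n i) / 2)"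
      using p[of i] qp[of i] by (simp add: powr_def l_def mult.commute)
  qed
  also have "(\<Prod>(i, j)\<in>?T. g i j) =
      \<alpha> ^ (\<Sum>j = 1..n. nat (v (j, j)) div 2) * \<beta> ^ card {i \<in> {1..n}. odd (v (i, 2*n + 1 - i))}"
  proof -
    have 1: "(\<Prod>j = 1..n. g j j) = \<alpha> ^ (\<Sum>j = 1..n. nat (v (j, j)) div 2)"
      unfolding power_sum
      by (intro prod.cong refl) (auto simp: g_def k_def scale_def triangle_def)
    have "(\<Prod>i = 1..n. g i (2*n + 1 - i)) = (\<Prod>i = 1..n. if odd (v (i, 2*n + 1 - i)) then \<beta> else 1)"
    proof (intro prod.cong refl)
      fix i assume i: "i \<in> {1..n}"
      have "k (i, 2*n + 1 - i) = nat (v (i, 2*n + 1 - i))" using i by (simp add: k_def scale_def triangle_def)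
      moreover have "i \<noteq> 2*n + 1 - i" "i + (2*n + 1 - i) = 2*n + 1" using i by auto
      ultimately show "g i (2*n + 1 - i) = (if odd (v (i, 2*n + 1 - i)) then \<beta> else 1)"
        using nonneg[of "(i, 2*n + 1 - i)"]
        by (simp add: g_def even_nat_iff mod_2_eq_odd)
    qed
    also have "\<dots> = \<beta> ^ card {i \<in> {1..n}. odd (v (i, 2*n + 1 - i))}"
      by (simp add: prod.If_cases Int_def)
    finally have 2: "(\<Prod>i = 1..n. g i (2*n + 1 - i)) = \<beta> ^ card {i \<in> {1..n}. odd (v (i, 2*n + 1 - i))}" .
    have 3: "(\<Prod>(i, j)\<in>?G. g i j * g i (2*n + 1 - j)) = 1"
      by (rule prod.neutral) (auto simp: g_def)
    show ?thesis unfolding prod_triangle 1 2 3 by simp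
  qed
  finally have eq: "(\<Prod>(i, j)\<in>?T. prob {\<omega> \<in> space M. W i j \<omega> = k (i, j)}) =
    (\<Prod>(i, j)\<in>?T. f i j) * (\<alpha> ^ (\<Sum>j = 1..n. nat (v (j, j)) div 2) *
      \<beta> ^ card {i \<in> {1..n}. odd (v (i, 2*n + 1 - i))} *
      (\<Prod>i = 1..n. p i powr (of_int (exponent v n i) / 2)))" .
  have norm: "(\<Prod>(i, j)\<in>?G. 1 / (1 - p i * p j)\<^sup>2)
         * (\<Prod>j = 1..n. (1 + \<beta> * p j) / (1 - (p j)\<^sup>2) * (1 / (1 - \<alpha> * p j)))
         * (\<Prod>(i, j)\<in>?T. f i j) = 1"
  proof -
    have fA: "f i (2*n + 1 - i) = (1 - (p i)\<^sup>2) / (1 + \<beta> * p i)" if "i \<in> {1..n}" for i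
    proof -
      have "i \<noteq> 2*n + 1 - i" "i + (2*n + 1 - i) = 2*n + 1" using that by auto
      then show ?thesis unfolding f_def using qp[OF that] by simp
    qed
    have fG: "f i j * f i (2*n + 1 - j) = (1 - p i * p j)\<^sup>2" if "(i, j) \<in> ?G" for i j
    proof -
      have ij: "i \<in> {1..n}" "j \<in> {1..n}" "i \<noteq> j" using that by auto
      have "i + j \<noteq> 2*n + 1" "i \<noteq> 2*n + 1 - j" "i + (2*n + 1 - j) \<noteq> 2*n + 1" using that by auto
      then show ?thesis unfolding f_def using qp[OF ij(1)] qp[OF ij(2)] ij(3) by (simp add: power2_eq_square)
    qed
    have G: "(\<Prod>(i, j)\<in>?G. 1 / (1 - p i * p j)\<^sup>2) * (\<Prod>(i, j)\<in>?G. f i j * f i (2*n + 1 - j)) = 1"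
      unfolding prod.distrib[symmetric]
    proof (rule prod.neutral, clarify)
      fix i j assume ij: "1 \<le> i" "i < j" "j \<le> n"
      have "p i * p j < 1 * 1" using p[of i] p[of j] ij by (intro mult_strict_mono) auto
      then show "1 / (1 - p i * p j)\<^sup>2 * (f i j * f i (2*n + 1 - j)) = 1" using fG[of i j] ij by simp
    qed
    have D: "(\<Prod>j = 1..n. (1 + \<beta> * p j) / (1 - (p j)\<^sup>2) * (1 / (1 - \<alpha> * p j))) *
       ((\<Prod>j = 1..n. f j j) * (\<Prod>i = 1..n. f i (2*n + 1 - i))) = 1"
      unfolding prod.distrib[symmetric]
    proof (rule prod.neutral, clarify)
      fix j assume j: "j \<in> {1..n}"
      have "(p j)\<^sup>2 < 1" using p[OF j] by (simp add: power_less_one_iff)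
      moreover have "0 < 1 + \<beta> * p j" using p[OF j] \<open>0 \<le> \<beta>\<close> by (simp add: add_pos_nonneg)
      moreover have "f j j = 1 - \<alpha> * p j" by (simp add: f_def)
      ultimately show "(1 + \<beta> * p j) / (1 - (p j)\<^sup>2) * (1 / (1 - \<alpha> * p j)) * (f j j * f j (2*n + 1 - j)) = 1"
        using \<alpha>[OF j] fA[OF j] by simp
    qed
    have "x * z * (w * y) = 1" if "x * y = 1" "z * w = 1" for x y z w :: real
      using that by algebra
    from this[OF G D] show ?thesis unfolding prod_triangle .
  qed
  show ?thesis using eq norm unfolding k_def by (simp add: mult.assoc[symmetric])
qed

end

subsection \<open>Split orthogonal patterns as arrays\<close>

lemma alternating_sum_eq_odd: "(\<Sum>i = 1..c. (- 1 :: int) ^ (i + 1)) = of_bool (odd c)"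
  by (induction c) auto

text \<open>The indices \<open>i\<close> with \<open>k \<le> \<mu> i\<close> form an initial segment
  of length \<open>conjugate \<mu> k\<close>, over which the alternating signs sum to 1 or 0
  according to the parity of that length. Summing over \<open>k\<close> and exchanging the sums
  recovers the parts.\<close>

lemma oddrows_conjugate:
  assumes anti: "\<And>i j. 1 \<le> i \<Longrightarrow> i \<le> j \<Longrightarrow> j \<le> n \<Longrightarrow> \<mu> j \<le> \<mu> i"
    and zero: "\<And>i. n < i \<Longrightarrow> \<mu> i = 0"
  shows "int (oddrows (conjugate \<mu>)) = (\<Sum>i = 1..n. (- 1) ^ (i + 1) * int (\<mu> i))"
proof -
  let ?c = "conjugate \<mu>"
  define K where "K = (\<Sum>i = 1..n. \<mu> i)"
  have le_K: "\<mu> i \<le> K" if "i \<in> {1..n}" for i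
    unfolding K_def using that by (intro member_le_sum) auto
  have mem_iff: "?c k \<le> n" "\<And>i. 1 \<le> i \<Longrightarrow> k \<le> \<mu> i \<longleftrightarrow> i \<le> ?c k" if k: "1 \<le> k" for k
  proof -
    let ?S = "{i. 1 \<le> i \<and> k \<le> \<mu> i}"
    have S: "?S \<subseteq> {1..n}"
      using zero k by (force simp: not_less[symmetric])
    then have fin: "finite ?S" by (rule finite_subset) simp
    \<comment> \<open>The inserted 0 yields the empty segment when no part reaches
      \<open>k\<close>.\<close>
    have "?S = {1..Max (insert 0 ?S)}"
    proof (cases "?S = {}")
      case False
      then have Max: "Max ?S \<in> ?S" "Max (insert 0 ?S) = Max ?S"
        using Max_in[OF fin False] Max_insert[OF fin False, of 0] by auto
      have "i \<in> ?S" if "i \<in> {1..Max ?S}" for i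
      proof -
        have "Max ?S \<le> n" "k \<le> \<mu> (Max ?S)" using subsetD[OF S Max(1)] Max(1) by simp_all
        then show ?thesis using anti[of i "Max ?S"] that by simp
      qed
      moreover have "i \<in> {1..Max ?S}" if "i \<in> ?S" for i
        using Max_ge[OF fin that] that by simp
      ultimately show ?thesis unfolding Max(2) by (intro equalityI subsetI)
    next
      case True
      show ?thesis unfolding True by simp
    qed
    then obtain M where M: "?S = {1..M}" by blast
    then have M': "?c k = M" by (simp add: conjugate_def)
    then show "?c k \<le> n" using M S card_mono[OF _ S] by (simp add: conjugate_def)
    fix i :: nat assume "1 \<le> i"
    moreover have "i \<in> ?S \<longleftrightarrow> i \<in> {1..?c k}" unfolding M M' ..
    ultimately show "k \<le> \<mu> i \<longleftrightarrow> i \<le> ?c k" by simp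
  qed
  have row: "(\<Sum>i = 1..n. (- 1) ^ (i + 1) * of_bool (k \<le> \<mu> i)) = (of_bool (odd (?c k)) :: int)"
    if k: "1 \<le> k" for k
  proof -
    have "(\<Sum>i = 1..n. (- 1) ^ (i + 1) * of_bool (k \<le> \<mu> i)) = (\<Sum>i = 1..?c k. (- 1 :: int) ^ (i + 1))"
      using mem_iff[OF k] by (intro sum.mono_neutral_cong_right) auto
    then show ?thesis unfolding alternating_sum_eq_odd .
  qed
  have odd_set: "{k. 1 \<le> k \<and> odd (?c k)} = {k \<in> {1..K}. odd (?c k)}"
  proof -
    have "k \<le> K" if k: "1 \<le> k" and "odd (?c k)" for k
    proof -
      have "1 \<le> ?c k" using that by (cases "?c k") auto
      then have "k \<le> \<mu> 1" "1 \<le> n" using mem_iff[OF k] by auto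
      then show ?thesis using le_K[of 1] by simp
    qed
    then show ?thesis by auto
  qed
  have "int (oddrows ?c) = (\<Sum>k = 1..K. of_bool (odd (?c k)))"
    unfolding oddrows_def odd_set by (simp add: sum.If_cases of_bool_def Int_def)
  also have "\<dots> = (\<Sum>k = 1..K. \<Sum>i = 1..n. (- 1) ^ (i + 1) * of_bool (k \<le> \<mu> i))"
    by (intro sum.cong refl row[symmetric]) auto
  also have "\<dots> = (\<Sum>i = 1..n. (- 1) ^ (i + 1) * (\<Sum>k = 1..K. of_bool (k \<le> \<mu> i)))"
    unfolding sum_distrib_left by (rule sum.swap)
  also have "\<dots> = (\<Sum>i = 1..n. (- 1) ^ (i + 1) * int (\<mu> i))"
  proof (intro sum.cong refl arg_cong2[where f = "(*)"])
    fix i assume "i \<in> {1..n}"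
    then have "{1..K} \<inter> {k. k \<le> \<mu> i} = {1..\<mu> i}" using le_K by force
    then show "(\<Sum>k = 1..K. of_bool (k \<le> \<mu> i)) = int (\<mu> i)"
      by (simp add: sum.If_cases of_bool_def)
  qed
  finally show ?thesis .
qed

section \<open>Change of coordinates between arrays and patterns\<close>

definition pattern_of_array :: "nat \<Rightarrow> real \<Rightarrow> (nat \<times> nat \<Rightarrow> int) \<Rightarrow> nat \<times> nat \<Rightarrow> real" where
  "pattern_of_array n u t =
     restrict (\<lambda>(k, a). u - of_int (t (a, a + (2*n - k))) / 2) (pattern_index n)"

text \<open>The floor only changes the type: \<open>2 * (u - z e)\<close> is already integral at
  every entry of a pattern whose shape lies in the box.\<close>

definition array_of_pattern :: "nat \<Rightarrow> real \<Rightarrow> (nat \<times> nat \<Rightarrow> real) \<Rightarrow> nat \<times> nat \<Rightarrow> int" where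
  "array_of_pattern n u z =
     (\<lambda>(i, j). if (i, j) \<in> triangle (2*n + 1) then \<lfloor>2 * (u - z (2*n + i - j, i))\<rfloor> else 0)"

definition shape_of_array :: "nat \<Rightarrow> real \<Rightarrow> (nat \<times> nat \<Rightarrow> int) \<Rightarrow> nat \<Rightarrow> real" where
  "shape_of_array n u t = restrict (\<lambda>j. u - of_int (t (j, j)) / 2) {1..n}"

lemma triangle_iff_pattern_index:
  "(i, j) \<in> triangle (2*n + 1) \<longleftrightarrow> i \<le> j \<and> j < 2*n + i \<and> (2*n + i - j, i) \<in> pattern_index n"
  unfolding triangle_def pattern_index_def by auto

lemma pattern_index_iff_triangle:
  "(k, a) \<in> pattern_index n \<longleftrightarrow> 1 \<le> k \<and> k \<le> 2*n \<and> (a, a + (2*n - k)) \<in> triangle (2*n + 1)"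
  unfolding triangle_def pattern_index_def by auto

text \<open>The odd ends correspond to the antidiagonal, the only place where an array may be odd;
  so they alone can be atypical.\<close>

lemma odd_end_iff:
  assumes "(k, a) \<in> pattern_index n"
  shows "(k, a) \<in> odd_ends n \<longleftrightarrow> (a, a + (2*n - k)) \<notin> triangle (2*n)"
  using assms unfolding triangle_def pattern_index_def odd_ends_def by auto

lemma half_integers_iff: "x \<in> half_integers \<longleftrightarrow> 2 * x \<in> \<int> \<and> x \<notin> \<int>"
proof
  assume "x \<in> half_integers"
  then obtain a where "x - 1/2 = of_int a" by (auto simp: half_integers_def elim: Ints_cases)
  then have x: "x = of_int a + 1/2" by simp
  then have "2 * x = of_int (2 * a + 1)" by simp
  moreover have "x \<noteq> of_int b" for b
  proof
    assume "x = of_int b"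
    then have "real_of_int (2 * a + 1) = of_int (2 * b)" using x by simp
    then have "2 * a + 1 = 2 * b" by linarith
    then show False by presburger
  qed
  ultimately show "2 * x \<in> \<int> \<and> x \<notin> \<int>" by (metis Ints_cases Ints_of_int)
next
  assume "2 * x \<in> \<int> \<and> x \<notin> \<int>"
  then obtain a where a: "2 * x = of_int a" "x \<notin> \<int>" by (auto elim: Ints_cases)
  have "odd a"
  proof
    assume "even a"
    then obtain b where "a = 2 * b" by blast
    then have "x = of_int b" using a by simp
    then show False using a by simp
  qed
  then obtain b where "a = 2 * b + 1" by (elim oddE)
  then have "x - 1/2 = of_int b" using a by simp
  then show "x \<in> half_integers" by (simp add: half_integers_def)
qed

lemma half_in_Ints_iff: "real_of_int a / 2 \<in> \<int> \<longleftrightarrow> even a"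
proof
  assume "real_of_int a / 2 \<in> \<int>"
  then obtain b where "real_of_int a / 2 = of_int b" by (auto elim: Ints_cases)
  then have "real_of_int a = of_int (2 * b)" by simp
  then have "a = 2 * b" by linarith
  then show "even a" by simp
qed auto

lemma minus_half_in_Ints_iff:
  assumes "u = real m / 2"
  shows "u - of_int a / 2 \<in> \<int> \<longleftrightarrow> (even a \<longleftrightarrow> even m)"
    "u - of_int a / 2 \<in> half_integers \<longleftrightarrow> \<not> (even a \<longleftrightarrow> even m)"
proof -
  have eq: "u - of_int a / 2 = real_of_int (int m - a) / 2" using assms by (simp add: field_simps)
  show 1: "u - of_int a / 2 \<in> \<int> \<longleftrightarrow> (even a \<longleftrightarrow> even m)"
    unfolding eq half_in_Ints_iff by auto
  have "2 * (u - of_int a / 2) \<in> \<int>" unfolding eq by (metis Ints_of_int nonzero_mult_div_cancel_left times_divide_eq_right zero_neq_numeral)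
  then show "u - of_int a / 2 \<in> half_integers \<longleftrightarrow> \<not> (even a \<longleftrightarrow> even m)"
    unfolding half_integers_iff 1 by simp
qed

lemma even_entry:
  assumes "t \<in> bounded_outputs n m" "x \<in> triangle (2*n)"
  shows "even (t x)"
  using assms by (auto simp: bounded_outputs_def arrays_def)

lemma array_le_up:
  assumes "t \<in> bounded_outputs n m" "(i, j) \<in> triangle (2*n + 1)"
  shows "t (i - 1, j) \<le> t (i, j)" "i < j \<Longrightarrow> t (i, j - 1) \<le> t (i, j)"
proof -
  have "lo t i j \<le> t (i, j)" using assms by (auto simp: bounded_outputs_def arrays_def)
  then show "t (i - 1, j) \<le> t (i, j)" "i < j \<Longrightarrow> t (i, j - 1) \<le> t (i, j)"
    by (auto simp: lo_def split: if_splits)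
qed

lemma diagonal_mono:
  assumes t: "t \<in> bounded_outputs n m" and "i \<le> j" "j \<le> n" "1 \<le> i"
  shows "t (i, i) \<le> t (j, j)"
  using assms(2,3)
proof (induction j rule: dec_induct)
  case (step j)
  have T: "(j, Suc j) \<in> triangle (2*n + 1)" "(Suc j, Suc j) \<in> triangle (2*n + 1)"
    using step assms by (auto simp: triangle_def)
  have "t (i, i) \<le> t (j, j)" using step by simp
  also have "\<dots> \<le> t (j, Suc j)" using array_le_up(2)[OF t T(1)] by simp
  also have "\<dots> \<le> t (Suc j, Suc j)" using array_le_up(1)[OF t T(2)] by simp
  finally show ?case .
qed simp

lemma array_of_pattern_of_array:
  assumes "t \<in> bounded_outputs n m"
  shows "array_of_pattern n u (pattern_of_array n u t) = t"
proof
  fix x :: "nat \<times> nat"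
  obtain i j where x: "x = (i, j)" by force
  show "array_of_pattern n u (pattern_of_array n u t) x = t x"
  proof (cases "(i, j) \<in> triangle (2*n + 1)")
    case True
    then have ij: "i \<le> j" "j < 2*n + i" "(2*n + i - j, i) \<in> pattern_index n"
      unfolding triangle_iff_pattern_index by auto
    then have "i + (2*n - (2*n + i - j)) = j" by auto
    then have "2 * (u - pattern_of_array n u t (2*n + i - j, i)) = of_int (t (i, j))"
      using ij(3) by (simp add: pattern_of_array_def)
    then show ?thesis using True by (simp add: array_of_pattern_def x)
  next
    case False
    then show ?thesis using assms by (auto simp: array_of_pattern_def x bounded_outputs_def arrays_def)
  qed
qed

text \<open>Subtraction from \<open>u\<close> reverses the order: growth along columns and rows
  becomes the two interlacing conditions, the bound by \<open>m\<close> becomes nonnegativity, and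
  nonnegativity becomes containment of the shape in the box. Evenness before the antidiagonal puts
  all entries but the odd ends in the class of \<open>u\<close>.\<close>

lemma pattern_of_array_in:
  assumes t: "t \<in> bounded_outputs n m" and n: "1 \<le> n" and u: "u = real m / 2"
  shows "shape_of_array n u t \<in> partitions_in_box n u"
    "pattern_of_array n u t \<in> patterns_of_shape n (shape_of_array n u t)"
proof -
  let ?z = "pattern_of_array n u t" and ?lam = "shape_of_array n u t"
  have range: "0 \<le> t x" "t x \<le> int m" for x
    using t by (cases x; auto simp: bounded_outputs_def arrays_def)+
  have nonneg: "0 \<le> u - of_int (t x) / 2" for x
    using range(2)[of x] unfolding u by linarith
  have u_Int: "u \<in> \<int> \<longleftrightarrow> even m" using minus_half_in_Ints_iff(1)[OF u, of 0] by simp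
  have diag: "(j, j) \<in> triangle (2*n)" if "j \<in> {1..n}" for j using that by (auto simp: triangle_def)
  have lam: "?lam j = u - of_int (t (j, j)) / 2" if "j \<in> {1..n}" for j
    using that by (simp add: shape_of_array_def)
  have "?lam \<in> extensional {1..n}" by (simp add: shape_of_array_def)
  moreover have "antimono_on {1..n} ?lam"
    by (intro monotone_onI) (use diagonal_mono[OF t] in \<open>auto simp: lam\<close>)
  moreover have "?lam 1 \<le> u" using lam[of 1] n range(1)[of "(1, 1)"] by simp
  moreover have "?lam j \<in> (if even m then \<int> else half_integers) \<and> 0 \<le> ?lam j" if "j \<in> {1..n}" for j
    using lam[OF that] nonneg even_entry[OF t diag[OF that]] minus_half_in_Ints_iff[OF u, of "t (j, j)"] by auto
  ultimately show "?lam \<in> partitions_in_box n u"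
    unfolding partitions_in_box_def u_Int n_partition_def n_half_partition_def by auto
  have z: "?z (k, a) = u - of_int (t (a, a + (2*n - k))) / 2" if "(k, a) \<in> pattern_index n" for k a
    using that by (simp add: pattern_of_array_def)
  have "split_orthogonal_pattern n ?z"
    unfolding split_orthogonal_pattern_def
  proof (intro conjI allI impI ballI)
    show "?z \<in> extensional (pattern_index n)" by (simp add: pattern_of_array_def)
  next
    fix i j assume ij: "(i, j) \<in> pattern_index n" "(i + 1, j + 1) \<in> pattern_index n"
    have "(j + 1, j + 1 + (2*n - (i + 1))) \<in> triangle (2*n + 1)"
      using ij(2) unfolding pattern_index_iff_triangle by blast
    from array_le_up(1)[OF t this] have "t (j, j + (2*n - i)) \<le> t (j + 1, j + 1 + (2*n - (i + 1)))"
      using ij by (simp add: pattern_index_def Suc_diff_Suc)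
    then show "?z (i + 1, j + 1) \<le> ?z (i, j)" unfolding z[OF ij(1)] z[OF ij(2)] by simp
  next
    fix i j assume ij: "(i, j) \<in> pattern_index n" "(i + 1, j) \<in> pattern_index n"
    have "(j, j + (2*n - i)) \<in> triangle (2*n + 1)"
      using ij(1) unfolding pattern_index_iff_triangle by blast
    from array_le_up(2)[OF t this] have "t (j, j + (2*n - (i + 1))) \<le> t (j, j + (2*n - i))"
      using ij by (simp add: pattern_index_def)
    then show "?z (i, j) \<le> ?z (i + 1, j)" unfolding z[OF ij(1)] z[OF ij(2)] by simp
  next
    fix e assume "e \<in> odd_ends n"
    then have "e \<in> pattern_index n" by (auto simp: odd_ends_def pattern_index_def)
    then obtain k a where e: "e = (k, a)" "(k, a) \<in> pattern_index n" by (cases e) auto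
    have "2 * ?z e = real (nat (int m - t (a, a + (2*n - k))))"
      using range(2) unfolding e(1) z[OF e(2)] unfolding u by (simp add: field_simps)
    then show "2 * ?z e \<in> \<nat>" by simp
  next
    have "?z e \<in> (if even m then \<int> else half_integers) \<and> 0 \<le> ?z e" if "e \<in> pattern_index n - odd_ends n" for e
    proof -
      obtain k a where e: "e = (k, a)" by force
      have "(a, a + (2*n - k)) \<in> triangle (2*n)" using that odd_end_iff unfolding e by blast
      then have "even (t (a, a + (2*n - k)))" by (rule even_entry[OF t])
      then show ?thesis using z[of k a] that nonneg minus_half_in_Ints_iff[OF u, of "t (a, a + (2*n - k))"]
        unfolding e by auto
    qed
    then show "(\<forall>e\<in>pattern_index n - odd_ends n. ?z e \<in> \<int> \<and> 0 \<le> ?z e) \<or>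
      (\<forall>e\<in>pattern_index n - odd_ends n. ?z e \<in> half_integers \<and> 0 \<le> ?z e)"
      by (cases "even m") auto
  qed
  moreover have "?z (2*n, j) = ?lam j" if "j \<in> {1..n}" for j
    using that lam[OF that] z[of "2*n" j] by (auto simp: pattern_index_def)
  ultimately show "?z \<in> patterns_of_shape n ?lam" by (simp add: patterns_of_shape_def)
qed

lemma array_of_pattern_in:
  assumes lam: "lam \<in> partitions_in_box n u" and z: "z \<in> patterns_of_shape n lam"
    and n: "1 \<le> n" and u: "u = real m / 2"
  shows "array_of_pattern n u z \<in> bounded_outputs n m"
    "pattern_of_array n u (array_of_pattern n u z) = z"
    "shape_of_array n u (array_of_pattern n u z) = lam"
proof -
  let ?t = "array_of_pattern n u z"
  have sop: "z \<in> extensional (pattern_index n)"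
    "\<And>i j. (i, j) \<in> pattern_index n \<Longrightarrow> (i + 1, j + 1) \<in> pattern_index n \<Longrightarrow> z (i + 1, j + 1) \<le> z (i, j)"
    "\<And>i j. (i, j) \<in> pattern_index n \<Longrightarrow> (i + 1, j) \<in> pattern_index n \<Longrightarrow> z (i, j) \<le> z (i + 1, j)"
    "\<And>e. e \<in> odd_ends n \<Longrightarrow> 2 * z e \<in> \<nat>"
    "(\<forall>e\<in>pattern_index n - odd_ends n. z e \<in> \<int> \<and> 0 \<le> z e) \<or>
     (\<forall>e\<in>pattern_index n - odd_ends n. z e \<in> half_integers \<and> 0 \<le> z e)"
    "\<And>j. j \<in> {1..n} \<Longrightarrow> z (2*n, j) = lam j"
    using z unfolding patterns_of_shape_def split_orthogonal_pattern_def by blast+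
  have u_half: "u \<notin> \<int> \<Longrightarrow> u \<in> half_integers" unfolding half_integers_iff u by simp
  have lam_le: "lam j \<le> u" if "j \<in> {1..n}" for j
  proof -
    have "antimono_on {1..n} lam" "lam 1 \<le> u"
      using lam by (auto simp: partitions_in_box_def n_partition_def n_half_partition_def split: if_splits)
    then show ?thesis using monotone_onD[of "{1..n}" "(\<le>)" "(\<ge>)" lam 1 j] that n by force
  qed
  have lam1: "lam 1 \<in> (if u \<in> \<int> then \<int> else half_integers)"
    using lam n by (auto simp: partitions_in_box_def n_partition_def n_half_partition_def)
  have ext_lam: "lam \<in> extensional {1..n}"
    using lam by (auto simp: partitions_in_box_def n_partition_def n_half_partition_def split: if_splits)
  \<comment> \<open>The first entry of the last row is not an odd end, so it decides which
    alternative of \<open>sop(5)\<close> holds; being \<open>lam 1\<close>, it is of the same kind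
    as \<open>u\<close>.\<close>
  have top: "(2*n, 1) \<in> pattern_index n - odd_ends n" using n by (auto simp: pattern_index_def odd_ends_def)
  have ev: "(u - z e) \<in> \<int>" "0 \<le> z e" if e: "e \<in> pattern_index n - odd_ends n" for e
  proof -
    show "0 \<le> z e" using sop(5) e by auto
    show "u - z e \<in> \<int>"
    proof (cases "u \<in> \<int>")
      case True
      then have "z (2*n, 1) \<in> \<int>" using lam1 sop(6)[of 1] n by simp
      then have "z e \<in> \<int>" using sop(5) e top half_integers_iff by blast
      then show ?thesis using True by simp
    next
      case False
      then have "z (2*n, 1) \<notin> \<int>" using lam1 sop(6)[of 1] n half_integers_iff by simp
      then have "z e \<in> half_integers" using sop(5) e top by blast
      then have "u - 1/2 \<in> \<int>" "z e - 1/2 \<in> \<int>"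
        using u_half[OF False] unfolding half_integers_def by simp_all
      from Ints_diff[OF this] show ?thesis by simp
    qed
  qed
  have int2: "2 * (u - z e) \<in> \<int>" and nn: "0 \<le> z e" if e: "e \<in> pattern_index n" for e
  proof -
    have "2 * (u - z e) \<in> \<int> \<and> 0 \<le> z e"
    proof (cases "e \<in> odd_ends n")
      case True
      obtain k where k: "2 * z e = real k" using sop(4)[OF True] by (rule Nats_cases)
      then have "2 * (u - z e) = of_int (int m - int k)" by (simp add: u)
      then have "2 * (u - z e) \<in> \<int>" by (metis Ints_of_int)
      then show ?thesis using k by simp
    next
      case False
      then have "e \<in> pattern_index n - odd_ends n" using e by simp
      from ev[OF this] show ?thesis using Ints_mult[of 2 "u - z e"] by simp
    qed
    then show "2 * (u - z e) \<in> \<int>" "0 \<le> z e" by auto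
  qed
  \<comment> \<open>For fixed \<open>a\<close> the entries increase up to the last row, where they
    are parts of the shape and at most \<open>u\<close>. This makes the array nonnegative.\<close>
  have z_le: "z (k, a) \<le> u" if ka: "(k, a) \<in> pattern_index n" for k a
  proof -
    have k: "k \<le> 2*n" using ka by (auto simp: pattern_index_def)
    have mem: "(k', a) \<in> pattern_index n" if "k \<le> k'" "k' \<le> 2*n" for k'
      using ka that by (auto simp: pattern_index_def)
    have "z (k, a) \<le> z (k', a)" if "k \<le> k'" "k' \<le> 2*n" for k'
      using that
    proof (induction k' rule: dec_induct)
      case (step k')
      then have "(k', a) \<in> pattern_index n" "(k' + 1, a) \<in> pattern_index n" by (auto intro!: mem)
      from sop(3)[OF this] show ?case using step by simp
    qed simp
    from this[of "2*n"] have "z (k, a) \<le> z (2*n, a)" using k by simp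
    also have "a \<in> {1..n}" using ka by (auto simp: pattern_index_def)
    then have "z (2*n, a) \<le> u" using sop(6) lam_le by simp
    finally show ?thesis .
  qed
  have t: "real_of_int (?t (i, j)) = 2 * (u - z (2*n + i - j, i))" if "(i, j) \<in> triangle (2*n + 1)" for i j
    using int2[of "(2*n + i - j, i)"] that
    unfolding array_of_pattern_def triangle_iff_pattern_index by (auto simp: Ints_def)
  have t0: "?t x = 0" if "x \<notin> triangle (2*n + 1)" for x
    using that by (auto simp: array_of_pattern_def split: prod.splits)
  have pi: "(2*n + i - j, i) \<in> pattern_index n" if "(i, j) \<in> triangle (2*n + 1)" for i j
    using that triangle_iff_pattern_index by blast
  have range: "0 \<le> ?t (i, j)" "?t (i, j) \<le> int m" for i j
  proof -
    have "0 \<le> ?t (i, j) \<and> ?t (i, j) \<le> int m"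
    proof (cases "(i, j) \<in> triangle (2*n + 1)")
      case True
      then have "0 \<le> real_of_int (?t (i, j))" "real_of_int (?t (i, j)) \<le> real m"
        unfolding t[OF True] using z_le[OF pi[OF True]] nn[OF pi[OF True]] u by auto
      then show ?thesis by linarith
    qed (simp add: t0)
    then show "0 \<le> ?t (i, j)" "?t (i, j) \<le> int m" by auto
  qed
  have even: "even (?t (i, j))" if ij: "(i, j) \<in> triangle (2*n)" for i j
  proof -
    have T: "(i, j) \<in> triangle (2*n + 1)" using ij triangle_mono by blast
    have "i + (2*n - (2*n + i - j)) = j" using ij by (auto simp: triangle_def)
    then have "(2*n + i - j, i) \<notin> odd_ends n" using odd_end_iff[OF pi[OF T]] ij by simp
    then have "u - z (2*n + i - j, i) \<in> \<int>" using ev pi[OF T] by blast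
    moreover have "real_of_int (?t (i, j)) / 2 = u - z (2*n + i - j, i)" using t[OF T] by simp
    ultimately show ?thesis using half_in_Ints_iff by metis
  qed
  have mono: "lo ?t i j \<le> ?t (i, j)" if T: "(i, j) \<in> triangle (2*n + 1)" for i j
  proof -
    have ij: "1 \<le> i" "i \<le> j" "i + j \<le> 2*n + 1" using T by (auto simp: triangle_def)
    have "?t (i - 1, j) \<le> ?t (i, j)"
    proof (cases "i = 1")
      case True
      then have "?t (i - 1, j) = 0" by (intro t0) (simp add: triangle_def)
      then show ?thesis using range by simp
    next
      case False
      then have T': "(i - 1, j) \<in> triangle (2*n + 1)" using ij by (auto simp: triangle_def)
      have eq: "(2*n + (i - 1) - j) + 1 = 2*n + i - j" "(i - 1) + 1 = i" using ij False by auto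
      have "z (2*n + i - j, i) \<le> z (2*n + (i - 1) - j, i - 1)"
        using sop(2)[of "2*n + (i - 1) - j" "i - 1"] pi[OF T] pi[OF T'] unfolding eq by blast
      then have "real_of_int (?t (i - 1, j)) \<le> of_int (?t (i, j))" unfolding t[OF T] t[OF T'] by simp
      then show ?thesis by linarith
    qed
    moreover have "?t (i, j - 1) \<le> ?t (i, j)" if "i < j"
    proof -
      have T': "(i, j - 1) \<in> triangle (2*n + 1)" using ij that by (auto simp: triangle_def)
      have eq: "(2*n + i - j) + 1 = 2*n + i - (j - 1)" using ij that by auto
      have "z (2*n + i - j, i) \<le> z (2*n + i - (j - 1), i)"
        using sop(3)[of "2*n + i - j" i] pi[OF T] pi[OF T'] unfolding eq by blast
      then have "real_of_int (?t (i, j - 1)) \<le> of_int (?t (i, j))" unfolding t[OF T] t[OF T'] by simp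
      then show ?thesis by linarith
    qed
    ultimately show ?thesis by (auto simp: lo_def)
  qed
  show "?t \<in> bounded_outputs n m"
    unfolding bounded_outputs_def arrays_def using t0 range even mono by auto
  show "pattern_of_array n u ?t = z"
  proof (rule extensionalityI[where A = "pattern_index n"])
    fix e assume "e \<in> pattern_index n"
    moreover obtain k a where e: "e = (k, a)" by force
    ultimately have T: "1 \<le> k" "k \<le> 2*n" "(a, a + (2*n - k)) \<in> triangle (2*n + 1)" and "(k, a) \<in> pattern_index n"
      using pattern_index_iff_triangle by auto
    moreover have "2*n + a - (a + (2*n - k)) = k" using T by auto
    ultimately show "pattern_of_array n u ?t e = z e" using t[OF T(3)] by (simp add: pattern_of_array_def e diff_divide_distrib)
  qed (use sop in \<open>auto simp: pattern_of_array_def\<close>)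
  show "shape_of_array n u ?t = lam"
  proof (rule extensionalityI[where A = "{1..n}"])
    fix j assume j: "j \<in> {1..n}"
    then have "(j, j) \<in> triangle (2*n + 1)" by (auto simp: triangle_def)
    then show "shape_of_array n u ?t j = lam j" using j t[of j j] sop(6)[OF j] by (simp add: shape_of_array_def diff_divide_distrib)
  qed (use ext_lam in \<open>auto simp: shape_of_array_def\<close>)
qed

subsection \<open>The pattern sum\<close>

lemma finite_partitions_in_box:
  assumes n: "1 \<le> n" and u: "u = real m / 2"
  shows "finite (partitions_in_box n u)"
proof (rule finite_subset)
  show "partitions_in_box n u \<subseteq> (\<Pi>\<^sub>E i\<in>{1..n}. (\<lambda>k. real k / 2) ` {..m})"
  proof (intro subsetI PiE_I)
    fix lam i assume lam: "lam \<in> partitions_in_box n u" and i: "i \<in> {1..n}"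
    have "antimono_on {1..n} lam" "lam 1 \<le> u"
      using lam by (auto simp: partitions_in_box_def n_partition_def n_half_partition_def split: if_splits)
    then have "lam i \<le> u" using monotone_onD[of "{1..n}" "(\<le>)" "(\<ge>)" lam 1 i] i n by force
    moreover have "lam i \<in> \<int> \<or> lam i \<in> half_integers" "0 \<le> lam i"
      using lam i by (auto simp: partitions_in_box_def n_partition_def n_half_partition_def split: if_splits)
    then have "2 * lam i \<in> \<int>" by (auto simp: half_integers_iff)
    then obtain k where k: "2 * lam i = of_int k" by (rule Ints_cases)
    ultimately have "0 \<le> real_of_int k" "real_of_int k \<le> real m" using \<open>0 \<le> lam i\<close> u by auto
    then have "0 \<le> k" "k \<le> int m" by linarith+
    then have "lam i = real (nat k) / 2" "nat k \<le> m" using k by auto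
    then show "lam i \<in> (\<lambda>k. real k / 2) ` {..m}" by blast
  next
    fix lam i assume "lam \<in> partitions_in_box n u" "i \<notin> {1..n}"
    then show "lam i = undefined"
      by (auto simp: partitions_in_box_def n_partition_def n_half_partition_def extensional_def split: if_splits)
  qed
qed (auto intro: finite_PiE)

lemma sum_patterns_eq_sum_arrays:
  assumes n: "1 \<le> n" and u: "u = real m / 2"
  shows "(\<Sum>lam\<in>partitions_in_box n u. \<Sum>z\<in>patterns_of_shape n lam. (h lam z :: real)) =
    (\<Sum>t\<in>bounded_outputs n m. h (shape_of_array n u t) (pattern_of_array n u t))"
proof -
  have "finite (patterns_of_shape n lam)" if "lam \<in> partitions_in_box n u" for lam
  proof (rule finite_surj[OF finite_bounded_outputs])
    show "patterns_of_shape n lam \<subseteq> pattern_of_array n u ` bounded_outputs n m"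
      using array_of_pattern_in[OF that _ n u] by (metis image_iff subsetI)
  qed
  then have "(\<Sum>lam\<in>partitions_in_box n u. \<Sum>z\<in>patterns_of_shape n lam. h lam z) =
    (\<Sum>(lam, z)\<in>Sigma (partitions_in_box n u) (patterns_of_shape n). h lam z)"
    by (intro sum.Sigma finite_partitions_in_box[OF n u]) blast
  also have "\<dots> = (\<Sum>t\<in>bounded_outputs n m. h (shape_of_array n u t) (pattern_of_array n u t))"
    by (rule sum.reindex_bij_witness[of _ "\<lambda>t. (shape_of_array n u t, pattern_of_array n u t)"
          "\<lambda>(lam, z). array_of_pattern n u z"])
      (use array_of_pattern_in[OF _ _ n u] array_of_pattern_of_array pattern_of_array_in[OF _ n u] in auto)
  finally show ?thesis .
qed

text \<open>Each clause of the border invariant transports one statistic: the alternating sum gives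
  the power of \<open>\<alpha>\<close>, the passage time modulo 2 that of \<open>\<beta>\<close>,
  and the diagonal sums, being row sums of the pattern, the monomial.\<close>

lemma array_weight:
  assumes n: "1 \<le> n" and u: "u = real m / 2"
    and v: "v \<in> arrays (2*n + 1) {}" and t: "t \<in> bounded_outputs n m"
    and border: "\<forall>i\<in>{1..n}. border_inv v t i (2*n + 1 - i) \<and> border_inv v t i (2*n - i)"
  shows
    "oddrows (conjugate (box_complement n u (shape_of_array n u t))) = (\<Sum>j = 1..n. nat (v (j, j)) div 2)"
    and
    "card (atypical_entries n (pattern_of_array n u t)) = card {i \<in> {1..n}. odd (v (i, 2*n + 1 - i))}"
    and "i \<in> {1..n} \<Longrightarrow>
      pattern_type (pattern_of_array n u t) (2*i) - pattern_type (pattern_of_array n u t) (2*i - 1) =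
        of_int (exponent v n i) / 2 - u"
proof -
  let ?z = "pattern_of_array n u t" and ?lam = "shape_of_array n u t"
  have inv: "border_inv v t i (2*n + 1 - i)" "border_inv v t i (2*n - i)" if "i \<in> {1..n}" for i
    using border that by auto
  have t_nn: "0 \<le> t x" for x using t by (cases x) (auto simp: bounded_outputs_def arrays_def)
  have v_nn: "0 \<le> v x" for x using v by (cases x) (auto simp: arrays_def)
  have diag: "(j, j) \<in> triangle (2*n)" if "j \<in> {1..n}" for j using that by (auto simp: triangle_def)
  let ?\<mu> = "box_complement n u ?lam"
  have \<mu>: "2 * int (?\<mu> i) = t (n + 1 - i, n + 1 - i)" if "i \<in> {1..n}" for i
  proof -
    have i: "n + 1 - i \<in> {1..n}" using that by auto
    obtain b where b: "t (n + 1 - i, n + 1 - i) = 2 * b"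
      using even_entry[OF t diag[OF i]] by blast
    then have "u - ?lam (n + 1 - i) = of_int b" using i by (simp add: shape_of_array_def)
    moreover have "0 \<le> b" using t_nn[of "(n + 1 - i, n + 1 - i)"] b by simp
    ultimately show ?thesis using b that by (simp add: box_complement_def)
  qed
  have "int (oddrows (conjugate ?\<mu>)) = (\<Sum>i = 1..n. (- 1) ^ (i + 1) * int (?\<mu> i))"
  proof (rule oddrows_conjugate)
    fix i j :: nat assume ij: "1 \<le> i" "i \<le> j" "j \<le> n"
    then have "t (n + 1 - j, n + 1 - j) \<le> t (n + 1 - i, n + 1 - i)"
      by (intro diagonal_mono[OF t]) auto
    then show "?\<mu> j \<le> ?\<mu> i" using \<mu>[of i] \<mu>[of j] ij by simp
  qed (simp add: box_complement_def)
  then have "2 * int (oddrows (conjugate ?\<mu>)) = (\<Sum>i = 1..n. (- 1) ^ (i + 1) * (2 * int (?\<mu> i)))"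
    by (simp add: sum_distrib_left mult.left_commute)
  also have "\<dots> = (\<Sum>i = 1..n. (- 1) ^ (i + 1) * t (n + 1 - i, n + 1 - i))"
    by (intro sum.cong refl) (simp only: \<mu>)
  also have "\<dots> = (\<Sum>a = 1..n. (- 1) ^ (n + a) * t (a, a))"
  proof (rule sum.reindex_bij_witness[of _ "\<lambda>i. n + 1 - i" "\<lambda>i. n + 1 - i"])
    fix i assume i: "i \<in> {1..n}"
    have "even (n + (n + 1 - i)) \<longleftrightarrow> even (i + 1)" using i by auto
    then have "(- 1 :: int) ^ (n + (n + 1 - i)) = (- 1) ^ (i + 1)" by (simp only: minus_one_power_iff)
    then show "(- 1) ^ (n + (n + 1 - i)) * t (n + 1 - i, n + 1 - i) = (- 1) ^ (i + 1) * t (n + 1 - i, n + 1 - i)"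
      by (simp only:)
  qed auto
  \<comment> \<open>At \<open>i = n\<close> the second family of border boxes reaches
    \<open>(n, n)\<close>, where the alternating clause applies.\<close>
  also have "\<dots> = (\<Sum>j = 1..n. v (j, j))"
    using inv(2)[of n] n by (simp add: border_inv_def mult_2)
  also have "\<dots> = 2 * int (\<Sum>j = 1..n. nat (v (j, j)) div 2)"
    unfolding of_nat_sum sum_distrib_left
  proof (intro sum.cong refl)
    fix j assume "j \<in> {1..n}"
    then have "even (v (j, j))" using v diag by (auto simp: arrays_def)
    then show "v (j, j) = 2 * int (nat (v (j, j)) div 2)" using v_nn[of "(j, j)"] by (auto elim!: evenE)
  qed
  finally have "int (oddrows (conjugate ?\<mu>)) = int (\<Sum>j = 1..n. nat (v (j, j)) div 2)" by simp
  then show "oddrows (conjugate ?\<mu>) = (\<Sum>j = 1..n. nat (v (j, j)) div 2)" by (simp only: of_nat_eq_iff)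
  have z: "?z (k, a) = u - of_int (t (a, a + (2*n - k))) / 2" if "(k, a) \<in> pattern_index n" for k a
    using that by (simp add: pattern_of_array_def)
  have u_Int: "u \<in> \<int> \<longleftrightarrow> even m" using minus_half_in_Ints_iff(1)[OF u, of 0] by simp
  \<comment> \<open>The passage times one level before the antidiagonal are even array entries, so
    modulo 2 only the last weight remains.\<close>
  have odd_iff: "odd (t (i, 2*n + 1 - i)) \<longleftrightarrow> odd (v (i, 2*n + 1 - i))" if i: "i \<in> {1..n}" for i
  proof -
    define a where "a = i - 1"
    define b where "b = 2*n - i"
    have ab: "i = Suc a" "2*n + 1 - i = Suc b" "b = 2*n - i" using i by (auto simp: a_def b_def)
    have sym: "symmetrize v (Suc a, Suc b) = v (Suc a, Suc b)"
      using ab i by (auto simp: symmetrize_def)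
    have "t (i, 2*n + 1 - i) = max (lpp (symmetrize v) a (Suc b)) (lpp (symmetrize v) (Suc a) b) + v (i, 2*n + 1 - i)"
      using inv(1)[OF i] unfolding border_inv_def ab(2) unfolding ab(1) by (simp add: sym)
    moreover have "even (lpp (symmetrize v) (Suc a) b)"
    proof -
      have "lpp (symmetrize v) (Suc a) b = t (i, 2*n - i)"
        using inv(2)[OF i] unfolding border_inv_def by (simp add: ab(1)[symmetric] ab(3))
      moreover have "(i, 2*n - i) \<in> triangle (2*n)" using i by (auto simp: triangle_def)
      ultimately show ?thesis using even_entry[OF t] by simp
    qed
    moreover have "even (lpp (symmetrize v) a (Suc b))"
    proof (cases "a = 0")
      case False
      then have a: "a \<in> {1..n}" "2*n - a = Suc b" using i ab by auto
      have "lpp (symmetrize v) a (Suc b) = t (a, 2*n - a)"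
        using inv(2)[OF a(1)] unfolding border_inv_def a(2) by simp
      moreover have "(a, 2*n - a) \<in> triangle (2*n)" using a by (auto simp: triangle_def)
      ultimately show ?thesis using even_entry[OF t] by simp
    qed simp
    ultimately show ?thesis by (simp add: max_def)
  qed
  \<comment> \<open>The first entry of the last row comes from an even array value, so it has the
    class of \<open>u\<close>; an entry of the other class comes from an odd array value, whatever
    the parity of \<open>m\<close>.\<close>
  have "atypical_entries n ?z = {(k, a) \<in> pattern_index n. odd (t (a, a + (2*n - k)))}"
  proof -
    have "(2*n, 1) \<in> pattern_index n" using n by (auto simp: pattern_index_def)
    then have "?z (2*n, 1) = u - of_int (t (1, 1)) / 2" using z by simp
    then have "?z (2*n, 1) \<in> \<int> \<longleftrightarrow> even m"
      using minus_half_in_Ints_iff(1)[OF u, of "t (1, 1)"] even_entry[OF t diag[of 1]] n by simp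
    moreover have "?z (k, a) \<in> \<int> \<longleftrightarrow> (even (t (a, a + (2*n - k))) \<longleftrightarrow> even m)"
      "?z (k, a) \<in> half_integers \<longleftrightarrow> \<not> (even (t (a, a + (2*n - k))) \<longleftrightarrow> even m)"
      if "(k, a) \<in> pattern_index n" for k a
      unfolding z[OF that] using minus_half_in_Ints_iff[OF u] by auto
    ultimately show ?thesis unfolding atypical_entries_def by auto
  qed
  also have "\<dots> = (\<lambda>i. (2*i - 1, i)) ` {i \<in> {1..n}. odd (v (i, 2*n + 1 - i))}"
  proof (intro equalityI subrelI)
    fix k a assume "(k, a) \<in> {(k, a) \<in> pattern_index n. odd (t (a, a + (2*n - k)))}"
    then have ka: "(k, a) \<in> pattern_index n" "odd (t (a, a + (2*n - k)))" by auto
    then have "(a, a + (2*n - k)) \<notin> triangle (2*n)" using even_entry[OF t] by blast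
    then have "(k, a) \<in> odd_ends n" using odd_end_iff[OF ka(1)] by simp
    then have a: "a \<in> {1..n}" "k = 2*a - 1" by (auto simp: odd_ends_def)
    moreover from this have "a + (2*n - k) = 2*n + 1 - a" by auto
    ultimately show "(k, a) \<in> (\<lambda>i. (2*i - 1, i)) ` {i \<in> {1..n}. odd (v (i, 2*n + 1 - i))}"
      using odd_iff[OF a(1)] ka(2) by auto
  next
    fix k a assume "(k, a) \<in> (\<lambda>i. (2*i - 1, i)) ` {i \<in> {1..n}. odd (v (i, 2*n + 1 - i))}"
    then have a: "a \<in> {1..n}" "k = 2*a - 1" "odd (v (a, 2*n + 1 - a))" by auto
    then have "a + (2*n - k) = 2*n + 1 - a" by auto
    moreover have "(k, a) \<in> pattern_index n" using a by (auto simp: pattern_index_def)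
    ultimately show "(k, a) \<in> {(k, a) \<in> pattern_index n. odd (t (a, a + (2*n - k)))}"
      using odd_iff[OF a(1)] a(3) by simp
  qed
  finally show "card (atypical_entries n ?z) = card {i \<in> {1..n}. odd (v (i, 2*n + 1 - i))}"
    by (simp add: card_image inj_on_def)
  show "pattern_type ?z (2*i) - pattern_type ?z (2*i - 1) = of_int (exponent v n i) / 2 - u"
    if i: "i \<in> {1..n}"
  proof -
    have row: "(\<Sum>j = 1..c. ?z (k, j)) = real c * u - of_int (\<Sum>j = 1..c. t (j, j + (2*n - k))) / 2"
      if "k \<in> {1..2*n}" "c = (k + 1) div 2" for k c
    proof -
      have "(\<Sum>j = 1..c. ?z (k, j)) = (\<Sum>j = 1..c. u - of_int (t (j, j + (2*n - k))) / 2)"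
        using that by (intro sum.cong refl z) (auto simp: pattern_index_def)
      then show ?thesis by (simp add: sum_subtractf sum_divide_distrib)
    qed
    \<comment> \<open>The empty row \<open>c = 0\<close> is included because the formula is applied
      to \<open>i - 1\<close>.\<close>
    have even_row: "(\<Sum>j = 1..c. ?z (2*c, j)) = real c * u - of_int (rect v c (2*n - c)) / 2"
      if "c \<le> n" for c
    proof (cases "c = 0")
      case True
      then show ?thesis by (simp add: rect_def)
    next
      case False
      have eq: "2*n - c - c = 2*n - 2*c" by simp
      have "(\<Sum>j = 1..c. t (j, j + (2*n - 2*c))) = rect v c (2*n - c)"
        using inv(2)[of c] that False unfolding border_inv_def eq by simp
      then show ?thesis using row[of "2*c" c] that False by simp
    qed
    have odd_row: "(\<Sum>j = 1..i. ?z (2*i - 1, j)) = real i * u - of_int (rect v i (2*n + 1 - i)) / 2"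
    proof -
      have eq: "2*n + 1 - i - i = 2*n - (2*i - 1)" using i by auto
      have "2*i - 1 \<in> {1..2*n}" "i = (2*i - 1 + 1) div 2" using i by auto
      note row[OF this]
      also have "(\<Sum>j = 1..i. t (j, j + (2*n - (2*i - 1)))) = rect v i (2*n + 1 - i)"
        using inv(1)[OF i] unfolding border_inv_def eq by simp
      finally show ?thesis .
    qed
    have halves: "(2*i + 1) div 2 = i" "2*i div 2 = i" "(2*i - 1 + 1) div 2 = i" "(2*i - 1) div 2 = i - 1"
      "2*i - 1 - 1 = 2*(i - 1)" "2*n - (i - 1) = 2*n + 1 - i"
      using i by auto
    have "real (i - 1) = real i - 1" using i by auto
    then show ?thesis
      unfolding pattern_type_def halves exponent_def
      using even_row[of i] even_row[of "i - 1"] odd_row i unfolding halves by (simp add: field_simps)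
  qed
qed

theorem theorem4p9:
  fixes M :: "'a measure" and n :: nat and p :: "nat \<Rightarrow> real" and \<alpha> \<beta> u :: real
    and W :: "nat \<Rightarrow> nat \<Rightarrow> 'a \<Rightarrow> nat"
  assumes "n \<ge> 1"
    and "\<And>j. j \<in> {1..n} \<Longrightarrow> 0 < p j \<and> p j < 1"
    and "\<beta> \<ge> 0" and "\<alpha> \<ge> 0"
    and "\<And>j. j \<in> {1..n} \<Longrightarrow> \<alpha> * p j < 1"
    and "doubly_symmetric_weights M n p \<alpha> \<beta> W"
    and "2 * u \<in> \<nat>"
  shows "(\<Prod>(i, j)\<in>{(i, j). 1 \<le> i \<and> i < j \<and> j \<le> n}. 1 / (1 - p i * p j)\<^sup>2)
         * (\<Prod>j = 1..n. (1 + \<beta> * p j) / (1 - (p j)\<^sup>2) * (1 / (1 - \<alpha> * p j)))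
         * measure M {\<omega> \<in> space M.
             real (last_passage_time (\<lambda>i j. W i j \<omega>) (2*n) (2*n)) \<le> 2 * u}
       = (\<Prod>i = 1..n. p i) powr u
         * (\<Sum>lam\<in>partitions_in_box n u.
              \<alpha> ^ oddrows (conjugate (box_complement n u lam)) * schur_CB n lam p \<beta>)"
proof -
  interpret doubly_symmetric_weights M n p \<alpha> \<beta> W by fact
  obtain m where m: "2 * u = real m" using \<open>2 * u \<in> \<nat>\<close> by (rule Nats_cases)
  then have u: "u = real m / 2" by simp
  let ?c = "(\<Prod>(i, j)\<in>{(i, j). 1 \<le> i \<and> i < j \<and> j \<le> n}. 1 / (1 - p i * p j)\<^sup>2)
         * (\<Prod>j = 1..n. (1 + \<beta> * p j) / (1 - (p j)\<^sup>2) * (1 / (1 - \<alpha> * p j)))"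
  let ?g = "\<lambda>v. \<alpha> ^ (\<Sum>j = 1..n. nat (v (j, j)) div 2) * \<beta> ^ card {i \<in> {1..n}. odd (v (i, 2*n + 1 - i))} *
    (\<Prod>i = 1..n. p i powr (of_int (exponent v n i) / 2))"
  let ?h = "\<lambda>lam z. (\<Prod>i = 1..n. p i) powr u * (\<alpha> ^ oddrows (conjugate (box_complement n u lam)) *
     (\<beta> ^ card (atypical_entries n z) *
        (\<Prod>i = 1..n. p i powr (pattern_type z (2*i) - pattern_type z (2*i - 1)))))"
  obtain \<Phi> where \<Phi>: "bij_betw \<Phi> (bounded_inputs n m) (bounded_outputs n m)"
    "\<forall>v\<in>arrays (2*n + 1) {}. \<forall>i\<in>{1..n}. border_inv v (\<Phi> v) i (2*n + 1 - i) \<and> border_inv v (\<Phi> v) i (2*n - i)"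
    using bounded_bijection[of n m] by blast
  have "?c * measure M {\<omega> \<in> space M. real (last_passage_time (\<lambda>i j. W i j \<omega>) (2*n) (2*n)) \<le> 2 * u} =
      (\<Sum>v\<in>bounded_inputs n m. ?c * (\<Prod>(i, j)\<in>triangle (2*n + 1).
         prob {\<omega> \<in> space M. W i j \<omega> = nat (v (i, j)) div scale n (i, j)}))"
    unfolding m of_nat_le_iff prob_last_passage_time_le[OF \<open>n \<ge> 1\<close>] sum_distrib_left ..
  also have "\<dots> = (\<Sum>v\<in>bounded_inputs n m. ?g v)"
    by (intro sum.cong refl prod_prob_weight) (use assms in \<open>auto simp: bounded_inputs_def\<close>)
  also have "\<dots> = (\<Sum>v\<in>bounded_inputs n m. ?h (shape_of_array n u (\<Phi> v)) (pattern_of_array n u (\<Phi> v)))"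
  proof (intro sum.cong refl)
    fix v assume v: "v \<in> bounded_inputs n m"
    then have v': "v \<in> arrays (2*n + 1) {}" by (simp add: bounded_inputs_def)
    have "\<Phi> v \<in> bounded_outputs n m" using \<Phi>(1) v by (auto dest: bij_betwE)
    note weight = array_weight[OF \<open>n \<ge> 1\<close> u v' this bspec[OF \<Phi>(2) v']]
    \<comment> \<open>The prefactor supplies \<open>p i powr u\<close> for each \<open>i\<close>,
      which cancels the \<open>- u\<close> in the exponent of \<open>p i\<close>.\<close>
    have "(\<Prod>i = 1..n. p i) powr u *
        (\<Prod>i = 1..n. p i powr (pattern_type (pattern_of_array n u (\<Phi> v)) (2*i)
          - pattern_type (pattern_of_array n u (\<Phi> v)) (2*i - 1))) =
        (\<Prod>i = 1..n. p i powr u * p i powr (of_int (exponent v n i) / 2 - u))"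
      using assms(2) weight(3) by (simp add: prod.distrib prod_powr_distrib less_imp_le)
    also have "\<dots> = (\<Prod>i = 1..n. p i powr (of_int (exponent v n i) / 2))"
      using assms(2) by (intro prod.cong refl) (simp add: powr_add[symmetric])
    finally have powers: "(\<Prod>i = 1..n. p i) powr u *
        (\<Prod>i = 1..n. p i powr (pattern_type (pattern_of_array n u (\<Phi> v)) (2*i)
          - pattern_type (pattern_of_array n u (\<Phi> v)) (2*i - 1))) = (\<Prod>i = 1..n. p i powr (of_int (exponent v n i) / 2))"
      .
    have "a * b * c = x * (a * (b * y))" if "x * y = c" for a b c x y :: real
      using that by (simp add: mult_ac)
    from this[OF powers]
    show "?g v = ?h (shape_of_array n u (\<Phi> v)) (pattern_of_array n u (\<Phi> v))"
      unfolding weight(1) weight(2) .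
  qed
  also have "\<dots> = (\<Sum>t\<in>bounded_outputs n m. ?h (shape_of_array n u t) (pattern_of_array n u t))"
    by (rule sum.reindex_bij_betw[OF \<Phi>(1)])
  also have "\<dots> = (\<Sum>lam\<in>partitions_in_box n u. \<Sum>z\<in>patterns_of_shape n lam. ?h lam z)"
    by (rule sum_patterns_eq_sum_arrays[OF \<open>n \<ge> 1\<close> u, symmetric])
  also have "\<dots> = (\<Prod>i = 1..n. p i) powr u * (\<Sum>lam\<in>partitions_in_box n u.
      \<alpha> ^ oddrows (conjugate (box_complement n u lam)) * schur_CB n lam p \<beta>)"
    by (simp only: schur_CB_def sum_distrib_left)
  finally show ?thesis .
qed

end
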